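(* Let $P$ be a finite interval order. The length polyhedron $Q_P$ has a unique Schrijver system, and it is obtained from the system of all cycle inequalities of the key graph $G_P$ by discarding each cycle inequality that can be expressed as a non-negative integral linear combination of other cycle inequalities (i.e., ones not equivalent to the original inequality).
   Context: A finite partial order $P=([n],\prec)$ is an interval order if there are compact real intervals $I_x=[\ell_x,r_x]$ with $x\prec y$ iff $r_x<\ell_y$; write $x\parallel y$ if $x\ne y$ are incomparable. The canonical representation $[\ell_x,r_x]_{x\in[n]}$ of $P$ is the (unique) representation using the minimum number $m$ of distinct endpoints, placed at $0,\dots,m-1$. For $y\not\prec x$, the slack of $(x,y)$ there is $\ell_y-r_x-1$ if $x\prec y$, $r_y-\ell_x$ if $x\parallel y$, $r_x-\ell_x$ if $x=y$; slack-$0$ pairs are slack zero pairs, called cover pairs if $x\prec y$ and sharp pairs if $x\parallel y$. The key graph $G_P$ has vertex set $\{\rho_1,\dots,\rho_n\}$ and colored, weighted arcs, the weight being a linear inequality in variables $\ell_1,\dots,\ell_n,\rho_1,\dots,\rho_n$: a blue arc $\rho_x\to\rho_y$ of weight $\langle\ell_x+\rho_x+1\le\ell_y\rangle$ for each slack zero cover pair; a red arc $\rho_x\to\rho_y$ of weight $\langle\ell_x\le\ell_y+\rho_y\rangle$ for each slack zero sharp pair; a red loop at $\rho_x$ of weight $\langle-\rho_x\le0\rangle$ for each slack zero pair $(x,x)$. For a directed cycle $C$ (a loop counts as a cycle), summing the arc weights cancels all $\ell$-variables and gives its cycle inequality $\langle\gamma+\sum_{i\in A}\rho_i\le\sum_{j\in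 B}\rho_j\rangle$ ($\gamma$ = number of blue arcs of $C$; for consecutive arcs $\rho_x\to\rho_y\to\rho_z$ of $C$, $y\in A$ if both blue, $y\in B$ if both red). Two inequalities are equivalent if they coincide after simplification. The length polyhedron $Q_P\subseteq\mathbb R^n$ is the convex hull of the vectors $(r_x-\ell_x)_{x\in[n]}$ over all interval representations of $P$ with integer endpoints; it is known that $Q_P$ is a full-dimensional polyhedron (an affine cone with apex at the length vector of the canonical representation) equal to the set of $\rho\in\mathbb R^n$ satisfying all cycle inequalities of $G_P$. A system $A\boldsymbol x\le\boldsymbol b$ is totally dual integral (TDI) if for every integral $\boldsymbol c$ with $\max\{\boldsymbol c^T\boldsymbol x:A\boldsymbol x\le\boldsymbol b\}$ finite, $\min\{\boldsymbol b^T\boldsymbol y:A^T\boldsymbol y=\boldsymbol c,\boldsymbol y\ge0\}$ has an integral optimal solution. A Schrijver system of a polyhedron is a TDI system $A\boldsymbol x\le\boldsymbol b$ with $A$ integral defining it, such that no proper subsystem defining the same polyhedron is TDI. *)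

theory Defs
  imports "HOL-Analysis.Analysis"
begin

section \<open>Interval orders and the canonical representation\<close>

definition interval_rep ::
  "('n \<Rightarrow> 'n \<Rightarrow> bool) \<Rightarrow> ('n \<Rightarrow> real) \<Rightarrow> ('n \<Rightarrow> real) \<Rightarrow> bool" where
  "interval_rep prec l r \<longleftrightarrow>
     (\<forall>x. l x \<le> r x) \<and> (\<forall>x y. prec x y \<longleftrightarrow> r x < l y)"

definition interval_order :: "('n::finite \<Rightarrow> 'n \<Rightarrow> bool) \<Rightarrow> bool" where
  "interval_order prec \<longleftrightarrow> irreflp prec \<and> transp prec \<and> (\<exists>l r. interval_rep prec l r)"

definition endpoints :: "('n \<Rightarrow> real) \<Rightarrow> ('n \<Rightarrow> real) \<Rightarrow> real set" where
  "endpoints l r = range l \<union> range r"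

definition is_canonical_rep ::
  "('n::finite \<Rightarrow> 'n \<Rightarrow> bool) \<Rightarrow> ('n \<Rightarrow> real) \<Rightarrow> ('n \<Rightarrow> real) \<Rightarrow> bool" where
  "is_canonical_rep prec l r \<longleftrightarrow>
     interval_rep prec l r \<and>
     (\<forall>l' r'. interval_rep prec l' r' \<longrightarrow> card (endpoints l r) \<le> card (endpoints l' r')) \<and>
     endpoints l r = real ` {0..<card (endpoints l r)}"

text \<open>An interval order has exactly one canonical representation (Greenough), so the
  choice operator does not leave any freedom here.\<close>

definition canonical_rep ::
  "('n::finite \<Rightarrow> 'n \<Rightarrow> bool) \<Rightarrow> ('n \<Rightarrow> real) \<times> ('n \<Rightarrow> real)" where
  "canonical_rep prec = (SOME (l, r). is_canonical_rep prec l r)"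


section \<open>Slack and the key graph\<close>

definition incomparable :: "('n \<Rightarrow> 'n \<Rightarrow> bool) \<Rightarrow> 'n \<Rightarrow> 'n \<Rightarrow> bool" where
  "incomparable prec x y \<longleftrightarrow> x \<noteq> y \<and> \<not> prec x y \<and> \<not> prec y x"

text \<open>Meaningful only if \<open>\<not> prec y x\<close>; the last branch is then the case of
  incomparable \<open>x\<close> and \<open>y\<close>.\<close>

definition slack :: "('n::finite \<Rightarrow> 'n \<Rightarrow> bool) \<Rightarrow> 'n \<Rightarrow> 'n \<Rightarrow> real" where
  "slack prec x y =
     (let (l, r) = canonical_rep prec in
      if prec x y then l y - r x - 1
      else if x = y then r x - l x
      else r y - l x)"

definition slack_zero_pair :: "('n::finite \<Rightarrow> 'n \<Rightarrow> bool) \<Rightarrow> 'n \<Rightarrow> 'n \<Rightarrow> bool" where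
  "slack_zero_pair prec x y \<longleftrightarrow> \<not> prec y x \<and> slack prec x y = 0"

definition cover_pair :: "('n::finite \<Rightarrow> 'n \<Rightarrow> bool) \<Rightarrow> 'n \<Rightarrow> 'n \<Rightarrow> bool" where
  "cover_pair prec x y \<longleftrightarrow> slack_zero_pair prec x y \<and> prec x y"

definition sharp_pair :: "('n::finite \<Rightarrow> 'n \<Rightarrow> bool) \<Rightarrow> 'n \<Rightarrow> 'n \<Rightarrow> bool" where
  "sharp_pair prec x y \<longleftrightarrow> slack_zero_pair prec x y \<and> incomparable prec x y"

text \<open>The vertex \<open>\<rho>\<^sub>x\<close> of the key graph is represented by \<open>x\<close>.  No ordered pair of
  vertices carries both a blue and a red arc, so an arc is given by its two ends.\<close>

definition blue_arc :: "('n::finite \<Rightarrow> 'n \<Rightarrow> bool) \<Rightarrow> 'n \<Rightarrow> 'n \<Rightarrow> bool" where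
  "blue_arc prec x y \<longleftrightarrow> cover_pair prec x y"

definition red_arc :: "('n::finite \<Rightarrow> 'n \<Rightarrow> bool) \<Rightarrow> 'n \<Rightarrow> 'n \<Rightarrow> bool" where
  "red_arc prec x y \<longleftrightarrow> sharp_pair prec x y \<or> (x = y \<and> slack_zero_pair prec x x)"

definition key_arc :: "('n::finite \<Rightarrow> 'n \<Rightarrow> bool) \<Rightarrow> 'n \<Rightarrow> 'n \<Rightarrow> bool" where
  "key_arc prec x y \<longleftrightarrow> blue_arc prec x y \<or> red_arc prec x y"

text \<open>The triple \<open>(u, v, b)\<close> stands for the inequality \<open>u \<bullet> \<ell> + v \<bullet> \<rho> \<le> b\<close>.  The second
  branch is \<open>\<ell>\<^sub>x \<le> \<ell>\<^sub>y + \<rho>\<^sub>y\<close>, which for \<open>x = y\<close> is \<open>- \<rho>\<^sub>x \<le> 0\<close>.\<close>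

definition arc_weight ::
  "('n::finite \<Rightarrow> 'n \<Rightarrow> bool) \<Rightarrow> 'n \<Rightarrow> 'n \<Rightarrow> (real^'n) \<times> (real^'n) \<times> real" where
  "arc_weight prec x y =
     (if blue_arc prec x y then (axis x 1 - axis y 1, axis x 1, -1)
      else (axis x 1 - axis y 1, - axis y 1, 0))"


section \<open>Cycles and cycle inequalities\<close>

text \<open>A directed cycle is given by the list of its (distinct) vertices; \<open>cyc C i\<close> reads the
  list cyclically.  A list of length one is a loop.\<close>

definition cyc :: "'a list \<Rightarrow> nat \<Rightarrow> 'a" where
  "cyc C i = C ! (i mod length C)"

definition directed_cycle :: "('n::finite \<Rightarrow> 'n \<Rightarrow> bool) \<Rightarrow> 'n list \<Rightarrow> bool" where
  "directed_cycle prec C \<longleftrightarrow>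
     C \<noteq> [] \<and> distinct C \<and> (\<forall>i<length C. key_arc prec (cyc C i) (cyc C (i + 1)))"

definition cycle_gamma :: "('n::finite \<Rightarrow> 'n \<Rightarrow> bool) \<Rightarrow> 'n list \<Rightarrow> nat" where
  "cycle_gamma prec C = card {i. i < length C \<and> blue_arc prec (cyc C i) (cyc C (i + 1))}"

definition cycle_A :: "('n::finite \<Rightarrow> 'n \<Rightarrow> bool) \<Rightarrow> 'n list \<Rightarrow> 'n set" where
  "cycle_A prec C = {cyc C (i + 1) | i. i < length C \<and>
     blue_arc prec (cyc C i) (cyc C (i + 1)) \<and> blue_arc prec (cyc C (i + 1)) (cyc C (i + 2))}"

definition cycle_B :: "('n::finite \<Rightarrow> 'n \<Rightarrow> bool) \<Rightarrow> 'n list \<Rightarrow> 'n set" where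
  "cycle_B prec C = {cyc C (i + 1) | i. i < length C \<and>
     red_arc prec (cyc C i) (cyc C (i + 1)) \<and> red_arc prec (cyc C (i + 1)) (cyc C (i + 2))}"

text \<open>The pair \<open>(a, b)\<close> stands for the inequality \<open>a \<bullet> x \<le> b\<close>.  The inequality
  \<open>\<gamma> + (\<Sum>i\<in>A. \<rho>\<^sub>i) \<le> (\<Sum>j\<in>B. \<rho>\<^sub>j)\<close> is thus stored in the simplified form
  \<open>(\<Sum>i\<in>A. \<rho>\<^sub>i) - (\<Sum>j\<in>B. \<rho>\<^sub>j) \<le> - \<gamma>\<close>, and two cycle inequalities are equivalent iff the
  pairs are equal.\<close>

type_synonym 'n ineq = "(real^'n) \<times> real"

definition cycle_ineq :: "('n::finite \<Rightarrow> 'n \<Rightarrow> bool) \<Rightarrow> 'n list \<Rightarrow> 'n ineq" where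
  "cycle_ineq prec C =
     ((\<Sum>i\<in>cycle_A prec C. axis i 1) - (\<Sum>j\<in>cycle_B prec C. axis j 1),
      - real (cycle_gamma prec C))"

definition cycle_system :: "('n::finite \<Rightarrow> 'n \<Rightarrow> bool) \<Rightarrow> 'n ineq set" where
  "cycle_system prec = {cycle_ineq prec C | C. directed_cycle prec C}"

definition nonneg_int_combination :: "'n::finite ineq \<Rightarrow> 'n ineq set \<Rightarrow> bool" where
  "nonneg_int_combination I S \<longleftrightarrow> (\<exists>k :: 'n ineq \<Rightarrow> nat. I = (\<Sum>J\<in>S. real (k J) *\<^sub>R J))"

definition reduced_cycle_system :: "('n::finite \<Rightarrow> 'n \<Rightarrow> bool) \<Rightarrow> 'n ineq set" where
  "reduced_cycle_system prec =
     {I \<in> cycle_system prec. \<not> nonneg_int_combination I (cycle_system prec - {I})}"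


section \<open>The length polyhedron\<close>

definition length_polyhedron :: "('n::finite \<Rightarrow> 'n \<Rightarrow> bool) \<Rightarrow> (real^'n) set" where
  "length_polyhedron prec = convex hull
     {(\<chi> x. r x - l x) | l r. interval_rep prec l r \<and> range l \<subseteq> \<int> \<and> range r \<subseteq> \<int>}"


section \<open>Total dual integrality and Schrijver systems\<close>

definition integral_vec :: "real^'n \<Rightarrow> bool" where
  "integral_vec c \<longleftrightarrow> (\<forall>i. c $ i \<in> \<int>)"

definition solution_set :: "'n::finite ineq set \<Rightarrow> (real^'n) set" where
  "solution_set S = {x. \<forall>(a, b)\<in>S. a \<bullet> x \<le> b}"

definition has_finite_max :: "'n::finite ineq set \<Rightarrow> real^'n \<Rightarrow> bool" where
  "has_finite_max S c \<longleftrightarrow> (\<exists>x\<in>solution_set S. \<forall>z\<in>solution_set S. c \<bullet> z \<le> c \<bullet> x)"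

text \<open>A dual vector has one entry for each inequality of \<open>S\<close>; its values outside of \<open>S\<close>
  are irrelevant.\<close>

definition dual_feasible :: "'n::finite ineq set \<Rightarrow> real^'n \<Rightarrow> ('n ineq \<Rightarrow> real) \<Rightarrow> bool" where
  "dual_feasible S c y \<longleftrightarrow> (\<forall>I\<in>S. 0 \<le> y I) \<and> (\<Sum>I\<in>S. y I *\<^sub>R fst I) = c"

definition dual_value :: "'n::finite ineq set \<Rightarrow> ('n ineq \<Rightarrow> real) \<Rightarrow> real" where
  "dual_value S y = (\<Sum>I\<in>S. snd I * y I)"

definition dual_optimal :: "'n::finite ineq set \<Rightarrow> real^'n \<Rightarrow> ('n ineq \<Rightarrow> real) \<Rightarrow> bool" where
  "dual_optimal S c y \<longleftrightarrow>
     dual_feasible S c y \<and> (\<forall>z. dual_feasible S c z \<longrightarrow> dual_value S y \<le> dual_value S z)"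

definition TDI :: "'n::finite ineq set \<Rightarrow> bool" where
  "TDI S \<longleftrightarrow>
     (\<forall>c. integral_vec c \<and> has_finite_max S c \<longrightarrow>
        (\<exists>y. dual_optimal S c y \<and> (\<forall>I\<in>S. y I \<in> \<int>)))"

text \<open>Systems are finite sets of inequalities: neither the order of the rows nor a repeated
  row matters, as a repeated row could always be dropped from a TDI system.\<close>

definition schrijver_system :: "(real^'n::finite) set \<Rightarrow> 'n ineq set \<Rightarrow> bool" where
  "schrijver_system Q S \<longleftrightarrow>
     finite S \<and> (\<forall>(a, b)\<in>S. integral_vec a) \<and> solution_set S = Q \<and> TDI S \<and>
     (\<forall>T. T \<subset> S \<and> solution_set T = Q \<longrightarrow> \<not> TDI T)"


section \<open>Cycle inequalities are sums of arc weights\<close>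

lemma not_blue_and_red: "\<not> (blue_arc prec x y \<and> red_arc prec x y)"
  by (auto simp: blue_arc_def red_arc_def cover_pair_def sharp_pair_def incomparable_def
      slack_zero_pair_def)

lemma inj_on_cyc_Suc:
  assumes "C \<noteq> []" "distinct C"
  shows "inj_on (\<lambda>i. cyc C (i + 1)) {..<length C}"
proof (rule inj_onI)
  fix i j assume ij: "i \<in> {..<length C}" "j \<in> {..<length C}" "cyc C (i + 1) = cyc C (j + 1)"
  have "(i + 1) mod length C = (j + 1) mod length C"
    using ij assms nth_eq_iff_index_eq[OF assms(2)] by (simp add: cyc_def)
  then show "i = j" using ij(1,2) by (auto simp: mod_Suc split: if_splits)
qed

lemma sum_cyc_shift:
  fixes f :: "nat \<Rightarrow> 'b::ab_group_add"
  assumes "f (length C) = f 0"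
  shows "(\<Sum>i<length C. f (i + 1)) = (\<Sum>i<length C. f i)"
proof -
  have "(\<Sum>i<length C. f (Suc i)) - (\<Sum>i<length C. f i) = 0"
    using sum_lessThan_telescope[of f "length C"] assms by (simp add: sum_subtractf)
  then show ?thesis by simp
qed

lemma sum_axis_cyc:
  fixes C :: "'n::finite list"
  assumes "C \<noteq> []" "distinct C"
  shows "(\<Sum>j\<in>{cyc C (i + 1) | i. i < length C \<and> Q i}. axis j (1::real)) =
         (\<Sum>i<length C. if Q i then axis (cyc C (i + 1)) 1 else 0)"
proof -
  have "{cyc C (i + 1) | i. i < length C \<and> Q i} = (\<lambda>i. cyc C (i + 1)) ` {i \<in> {..<length C}. Q i}"
    by auto
  moreover have "inj_on (\<lambda>i. cyc C (i + 1)) {i \<in> {..<length C}. Q i}"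
    by (rule inj_on_subset[OF inj_on_cyc_Suc[OF assms]]) auto
  ultimately have "(\<Sum>j\<in>{cyc C (i + 1) | i. i < length C \<and> Q i}. axis j (1::real)) =
      (\<Sum>i\<in>{i \<in> {..<length C}. Q i}. axis (cyc C (i + 1)) 1)"
    by (simp add: sum.reindex)
  then show ?thesis by (simp only: sum.inter_filter[OF finite_lessThan])
qed

lemma sum_arc_weights:
  assumes C: "directed_cycle prec C"
  shows "(\<Sum>i<length C. arc_weight prec (cyc C i) (cyc C (i + 1))) = (0, cycle_ineq prec C)"
proof -
  have ne: "C \<noteq> []" and d: "distinct C"
    and arc: "\<And>i. i < length C \<Longrightarrow> key_arc prec (cyc C i) (cyc C (i + 1))"
    using C by (auto simp: directed_cycle_def)
  let ?b = "\<lambda>i. blue_arc prec (cyc C i) (cyc C (i + 1))"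
  let ?e = "\<lambda>i. axis (cyc C i) (1::real)"
  have per: "cyc C (length C + j) = cyc C j" for j by (simp add: cyc_def)
  have red: "red_arc prec (cyc C i) (cyc C (i + 1)) \<longleftrightarrow> \<not> ?b i" if "i \<le> length C" for i
  proof (cases "i = length C")
    case True
    then show ?thesis using arc[of 0] ne not_blue_and_red per[of 0] per[of 1]
      unfolding key_arc_def by auto
  next
    case False
    then show ?thesis using arc[of i] that not_blue_and_red unfolding key_arc_def by auto
  qed
  have 1: "(\<Sum>i<length C. ?e i - ?e (i + 1)) = 0"
    using sum_cyc_shift[of ?e C] per[of 0] by (simp add: sum_subtractf)
  have 2: "(\<Sum>i<length C. if ?b i then ?e i else - ?e (i + 1)) = fst (cycle_ineq prec C)"
  proof -
    have "(\<Sum>i<length C. if ?b i then ?e i else - ?e (i + 1)) =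
        (\<Sum>i<length C. if ?b i then ?e i else 0) - (\<Sum>i<length C. if ?b i then 0 else ?e (i + 1))"
      unfolding sum_subtractf[symmetric] by (rule sum.cong) auto
    also have "(\<Sum>i<length C. if ?b i then ?e i else 0) =
        (\<Sum>i<length C. if ?b (i + 1) then ?e (i + 1) else 0)"
      by (rule sum_cyc_shift[symmetric, where f = "\<lambda>i. if ?b i then ?e i else 0"])
         (use per[of 0] per[of 1] in simp)
    also have "\<dots> - (\<Sum>i<length C. if ?b i then 0 else ?e (i + 1)) =
        (\<Sum>i<length C. if ?b i \<and> ?b (i + 1) then ?e (i + 1) else 0) -
        (\<Sum>i<length C. if \<not> ?b i \<and> \<not> ?b (i + 1) then ?e (i + 1) else 0)"
      unfolding sum_subtractf[symmetric] by (rule sum.cong) auto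
    also have "(\<Sum>i<length C. if ?b i \<and> ?b (i + 1) then ?e (i + 1) else 0) =
        (\<Sum>j\<in>cycle_A prec C. axis j 1)"
      unfolding cycle_A_def sum_axis_cyc[OF ne d] by (simp add: numeral_2_eq_2)
    also have "(\<Sum>i<length C. if \<not> ?b i \<and> \<not> ?b (i + 1) then ?e (i + 1) else 0) =
        (\<Sum>j\<in>cycle_B prec C. axis j 1)"
      unfolding cycle_B_def sum_axis_cyc[OF ne d]
    proof (rule sum.cong[OF refl])
      fix i assume "i \<in> {..<length C}"
      then show "(if \<not> ?b i \<and> \<not> ?b (i + 1) then ?e (i + 1) else 0) =
        (if red_arc prec (cyc C i) (cyc C (i + 1)) \<and>
            red_arc prec (cyc C (i + 1)) (cyc C (i + 2)) then ?e (i + 1) else 0)"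
        using red[of i] red[of "i + 1"] by (simp add: numeral_2_eq_2)
    qed
    finally show ?thesis by (simp add: cycle_ineq_def)
  qed
  have 3: "(\<Sum>i<length C. if ?b i then -1 else (0::real)) = snd (cycle_ineq prec C)"
  proof -
    have "(\<Sum>i<length C. if ?b i then -1 else (0::real)) = (\<Sum>i\<in>{i \<in> {..<length C}. ?b i}. -1)"
      by (simp only: sum.inter_filter[OF finite_lessThan])
    then show ?thesis by (simp add: cycle_ineq_def cycle_gamma_def)
  qed
  have "arc_weight prec (cyc C i) (cyc C (i + 1)) =
      (?e i - ?e (i + 1), (if ?b i then ?e i else - ?e (i + 1)), (if ?b i then -1 else 0))" for i
    by (simp add: arc_weight_def)
  then have "(\<Sum>i<length C. arc_weight prec (cyc C i) (cyc C (i + 1))) =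
      ((\<Sum>i<length C. ?e i - ?e (i + 1)),
       (\<Sum>i<length C. if ?b i then ?e i else - ?e (i + 1)),
       (\<Sum>i<length C. if ?b i then -1 else 0))"
    by (simp only: sum_prod)
  then show ?thesis by (simp only: 1 2 3 prod.collapse)
qed

end

(*
All cycle inequalities are tight at p, the length vector of the canonical representation, so the
length polyhedron is a cone with apex p. It is full-dimensional: with l, r the canonical
representation, the direction with left endpoints 2 l and right endpoints 2 r + 1 satisfies every
homogeneous slack zero constraint strictly, so all rows are negative on its length vector delta. A TDI system of such a cone must contain every irreducible integral vector of the normal
cone at p, and these vectors form a TDI system. It remains to see that the cycle inequalities
generate all integral vectors c of the normal cone. Testing c on the indicator functions of closed
sets of endpoints gives the cut condition for an integral flow with net outflow c at the right
and -c at the left endpoints. Identifying the two endpoints of each element turns the flow into a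
circulation on the key graph, hence into a sum of directed cycles.

A solution of the cycle inequalities comes with a potential, which gives real endpoints satisfying
the slack zero constraints, hence all constraints. It is a convex combination of integral solutions
since rounding all endpoints simultaneously after a common shift preserves the constraints, and
averaging over the shifts recovers the lengths.
*)

theory Submission
  imports Defs
begin

section \<open>Schrijver systems of integral cones\<close>

lemma mem_solution_set: "z \<in> solution_set S \<longleftrightarrow> (\<forall>I\<in>S. fst I \<bullet> z \<le> snd I)"
  by (auto simp: solution_set_def)

section \<open>Arithmetic of non-negative integral combinations\<close>

lemma nonneg_int_combination_0: "nonneg_int_combination 0 S"
  unfolding nonneg_int_combination_def by (rule exI[of _ "\<lambda>_. 0"]) simp

lemma nonneg_int_combination_add:
  assumes "nonneg_int_combination I S" "nonneg_int_combination J S"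
  shows "nonneg_int_combination (I + J) S"
proof -
  obtain k m :: "'a ineq \<Rightarrow> nat" where "I = (\<Sum>K\<in>S. real (k K) *\<^sub>R K)" "J = (\<Sum>K\<in>S. real (m K) *\<^sub>R K)"
    using assms unfolding nonneg_int_combination_def by auto
  then have "I + J = (\<Sum>K\<in>S. real (k K + m K) *\<^sub>R K)"
    by (simp add: scaleR_add_left sum.distrib)
  then show ?thesis unfolding nonneg_int_combination_def by (rule exI[of _ "\<lambda>K. k K + m K"])
qed

lemma nonneg_int_combination_scale:
  "nonneg_int_combination I S \<Longrightarrow> nonneg_int_combination (real n *\<^sub>R I) S"
  by (induction n) (simp_all add: nonneg_int_combination_0 nonneg_int_combination_add scaleR_add_left)

lemma nonneg_int_combination_sum:
  "(\<And>J. J \<in> A \<Longrightarrow> nonneg_int_combination (g J) S) \<Longrightarrow> nonneg_int_combination (\<Sum>J\<in>A. g J) S"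
  by (induction A rule: infinite_finite_induct)
    (simp_all add: nonneg_int_combination_0 nonneg_int_combination_add)

lemma nonneg_int_combination_mem:
  assumes "finite S" "I \<in> S"
  shows "nonneg_int_combination I S"
proof -
  have "(\<Sum>K\<in>S. real (if K = I then 1 else 0) *\<^sub>R K) = (\<Sum>K\<in>S. if K = I then K else 0)"
    by (rule sum.cong) auto
  then have "I = (\<Sum>K\<in>S. real (if K = I then 1 else 0) *\<^sub>R K)" using assms by simp
  then show ?thesis unfolding nonneg_int_combination_def by (rule exI[of _ "\<lambda>K. if K = I then 1 else 0"])
qed

text \<open>Only rows with positive multiplicity have to be expanded, since the height arguments
  below give information about those rows alone.\<close>

lemma nonneg_int_combination_trans:
  assumes "I = (\<Sum>J\<in>S. real (k J) *\<^sub>R J)"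
    and "\<And>J. J \<in> S \<Longrightarrow> 0 < k J \<Longrightarrow> nonneg_int_combination J T"
  shows "nonneg_int_combination I T"
  unfolding assms(1)
proof (rule nonneg_int_combination_sum)
  fix J assume "J \<in> S"
  then show "nonneg_int_combination (real (k J) *\<^sub>R J) T"
    using assms(2)[of J] by (cases "k J = 0") (auto intro: nonneg_int_combination_0 nonneg_int_combination_scale)
qed

text \<open>Farkas' lemma at the point \<open>p\<close>, giving strong duality for linear programs
  that attain their maximum at \<open>p\<close>.\<close>

lemma farkas_at_point:
  fixes S :: "'n::finite ineq set"
  assumes S: "finite S" and p: "p \<in> solution_set S"
    and max: "\<And>z. z \<in> solution_set S \<Longrightarrow> c \<bullet> z \<le> c \<bullet> p"
  shows "\<exists>y. dual_feasible S c y \<and> dual_value S y = c \<bullet> p"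
proof -
  \<comment> \<open>An optimal dual solution can use only rows tight at \<open>p\<close>, so
    \<open>c\<close> is sought in the cone generated by these rows.\<close>
  define T where "T = {I \<in> S. fst I \<bullet> p = snd I}"
  have fT: "finite T" and TS: "T \<subseteq> S" using S by (auto simp: T_def)
  define K where "K = {(\<Sum>I\<in>T. y I *\<^sub>R fst I) | y. \<forall>I\<in>T. 0 \<le> y I}"
  have "convex_cone K"
    unfolding convex_cone_iff
  proof (intro conjI ballI allI impI)
    show "0 \<in> K" unfolding K_def by (auto intro!: exI[of _ "\<lambda>_. 0"])
  next
    fix u v assume "u \<in> K" "v \<in> K"
    then obtain f g where "u = (\<Sum>I\<in>T. f I *\<^sub>R fst I)" "\<forall>I\<in>T. 0 \<le> f I"
      "v = (\<Sum>I\<in>T. g I *\<^sub>R fst I)" "\<forall>I\<in>T. 0 \<le> g I" unfolding K_def by auto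
    then show "u + v \<in> K" unfolding K_def
      by (intro CollectI exI[of _ "\<lambda>I. f I + g I"]) (auto simp: scaleR_add_left sum.distrib)
  next
    fix u and a :: real assume "u \<in> K" "0 \<le> a"
    then obtain f where "u = (\<Sum>I\<in>T. f I *\<^sub>R fst I)" "\<forall>I\<in>T. 0 \<le> f I" unfolding K_def by auto
    then show "a *\<^sub>R u \<in> K" unfolding K_def using \<open>0 \<le> a\<close>
      by (intro CollectI exI[of _ "\<lambda>I. a * f I"]) (auto simp: scaleR_sum_right)
  qed
  moreover have "fst ` T \<subseteq> K"
  proof
    fix a assume "a \<in> fst ` T"
    then obtain J where J: "J \<in> T" "a = fst J" by auto
    have "(\<Sum>I\<in>T. (if I = J then 1 else 0) *\<^sub>R fst I) = (\<Sum>I\<in>T. if I = J then fst I else 0)"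
      by (rule sum.cong) auto
    then have "a = (\<Sum>I\<in>T. (if I = J then 1 else 0) *\<^sub>R fst I)" using J fT by simp
    then show "a \<in> K" unfolding K_def by (intro CollectI exI[of _ "\<lambda>I. if I = J then 1 else 0"]) auto
  qed
  ultimately have sub: "convex_cone hull (fst ` T) \<subseteq> K" by (rule hull_minimal[rotated])
  let ?H = "convex_cone hull (fst ` T)"
  have "c \<in> ?H"
  proof (rule ccontr)
    assume "c \<notin> ?H"
    moreover have "closed ?H" using fT by (simp add: closed_convex_cone_hull)
    moreover have cc: "convex_cone ?H" by (rule convex_cone_convex_cone_hull)
    ultimately obtain a b where ab: "a \<bullet> c < b" "\<And>x. x \<in> ?H \<Longrightarrow> a \<bullet> x > b"
      using separating_hyperplane_closed_point[of ?H c] convex_convex_cone_hull by blast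
    have b0: "b < 0" using ab(2)[OF convex_cone_hull_contains_0] by simp
    \<comment> \<open>A vector of the cone with negative product could be rescaled to have product
      exactly \<open>b\<close>, against the strict separation.\<close>
    have row: "0 \<le> a \<bullet> x" if "x \<in> ?H" for x
    proof (rule ccontr)
      assume n: "\<not> 0 \<le> a \<bullet> x"
      have "(b / (a \<bullet> x)) *\<^sub>R x \<in> ?H" using that n b0
        by (intro convex_cone_hull_mul) (auto simp: divide_nonpos_neg)
      from ab(2)[OF this] show False using n by simp
    qed
    define d where "d = - a"
    have dT: "fst I \<bullet> d \<le> 0" if "I \<in> T" for I
      using row[OF hull_inc[of "fst I"]] that by (auto simp: d_def inner_commute)
    have dc: "0 < c \<bullet> d" using ab(1) b0 by (simp add: d_def inner_commute)
    \<comment> \<open>Tight rows permit every positive step along \<open>d\<close>, the other rows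
      permit small steps by continuity. Such a step stays feasible and increases \<open>c\<close>,
      against the choice of \<open>p\<close>.\<close>
    have "\<forall>I\<in>S. eventually (\<lambda>e. fst I \<bullet> (p + e *\<^sub>R d) \<le> snd I) (at_right (0::real))"
    proof
      fix I assume I: "I \<in> S"
      show "eventually (\<lambda>e. fst I \<bullet> (p + e *\<^sub>R d) \<le> snd I) (at_right (0::real))"
      proof (cases "I \<in> T")
        case True
        have "eventually (\<lambda>e. e > 0) (at_right (0::real))" by (rule eventually_at_right_less)
        then show ?thesis
        proof eventually_elim
          case (elim e)
          have "e * (fst I \<bullet> d) \<le> 0" using elim dT[OF True] by (simp add: mult_nonneg_nonpos)
          then show ?case using True by (simp add: T_def inner_add_right)
        qed
      next
        case False
        have "fst I \<bullet> p \<le> snd I" using p I by (auto simp: solution_set_def split: prod.splits)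
        then have lt: "fst I \<bullet> p < snd I" using False I by (auto simp: T_def)
        have "((\<lambda>e. fst I \<bullet> (p + e *\<^sub>R d)) \<longlongrightarrow> fst I \<bullet> (p + 0 *\<^sub>R d)) (at_right (0::real))"
          by (intro tendsto_intros)
        then have "eventually (\<lambda>e. fst I \<bullet> (p + e *\<^sub>R d) < snd I) (at_right (0::real))"
          using lt by (intro order_tendstoD(2)) auto
        then show ?thesis by eventually_elim simp
      qed
    qed
    then have "eventually (\<lambda>e. \<forall>I\<in>S. fst I \<bullet> (p + e *\<^sub>R d) \<le> snd I) (at_right (0::real))"
      using S by (simp add: eventually_ball_finite)
    moreover have "eventually (\<lambda>e. e > 0) (at_right (0::real))" by (rule eventually_at_right_less)
    ultimately have "eventually (\<lambda>e. e > 0 \<and> (\<forall>I\<in>S. fst I \<bullet> (p + e *\<^sub>R d) \<le> snd I)) (at_right (0::real))"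
      by eventually_elim simp
    then obtain e :: real where e: "e > 0" "\<forall>I\<in>S. fst I \<bullet> (p + e *\<^sub>R d) \<le> snd I"
      using eventually_happens'[OF trivial_limit_at_right_real] by blast
    have "c \<bullet> (p + e *\<^sub>R d) \<le> c \<bullet> p"
      using e(2) by (intro max) (auto simp: solution_set_def)
    then show False using e(1) dc by (simp add: inner_add_right mult_le_0_iff)
  qed
  then obtain y where y: "c = (\<Sum>I\<in>T. y I *\<^sub>R fst I)" "\<forall>I\<in>T. 0 \<le> y I"
    using sub unfolding K_def by blast
  define z where "z I = (if I \<in> T then y I else 0)" for I
  have "(\<Sum>I\<in>S. z I *\<^sub>R fst I) = (\<Sum>I\<in>T. y I *\<^sub>R fst I)"
    by (rule sum.mono_neutral_cong_right) (use S TS in \<open>auto simp: z_def\<close>)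
  moreover have "dual_value S z = (\<Sum>I\<in>T. snd I * y I)" unfolding dual_value_def
    by (rule sum.mono_neutral_cong_right) (use S TS in \<open>auto simp: z_def\<close>)
  moreover have "\<dots> = c \<bullet> p" unfolding y(1) inner_sum_left
    by (rule sum.cong) (auto simp: T_def)
  ultimately show ?thesis using y by (intro exI[of _ z]) (auto simp: dual_feasible_def z_def)
qed

section \<open>Cones with a given apex whose rows are a Hilbert basis of the normal cone\<close>

text \<open>By \<open>tight\<close> the solution set is a cone with apex \<open>p\<close>, and
  \<open>generate\<close> makes the rows a Hilbert basis of its normal cone at \<open>p\<close>. The
  direction \<delta> of \<open>interior\<close> makes that normal cone pointed, which is why its
  irreducible elements are determined.\<close>

locale tight_system =
  fixes C :: "'n::finite ineq set" and p \<delta> :: "real^'n"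
  assumes finite_C: "finite C"
    and integral_C: "I \<in> C \<Longrightarrow> integral_vec (fst I)"
    and tight: "I \<in> C \<Longrightarrow> snd I = fst I \<bullet> p"
    and interior: "I \<in> C \<Longrightarrow> fst I \<bullet> \<delta> < 0"
    and generate: "integral_vec c \<Longrightarrow> (\<And>z. z \<in> solution_set C \<Longrightarrow> c \<bullet> z \<le> c \<bullet> p) \<Longrightarrow>
      nonneg_int_combination (c, c \<bullet> p) C"
begin

definition reduced :: "'n ineq set" where
  "reduced = {I \<in> C. \<not> nonneg_int_combination I (C - {I})}"

lemma reduced_subset: "reduced \<subseteq> C"
  by (auto simp: reduced_def)

lemma finite_reduced: "finite reduced"
  using finite_C reduced_subset by (rule finite_subset[rotated])

lemma apex_mem: "p \<in> solution_set C"
  using tight by (fastforce simp: solution_set_def)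

text \<open>The functional \<open>- \<delta>\<close> is positive on all rows, so it serves as a height: in a combination
  yielding a row \<open>I\<close>, a row of at least the same height must be \<open>I\<close> itself.\<close>

lemma combination_height:
  assumes I: "I = (\<Sum>J\<in>S. real (k J) *\<^sub>R J)" and S: "S \<subseteq> C"
    and K: "K \<in> S" "0 < k K"
  shows "fst I \<bullet> \<delta> \<le> fst K \<bullet> \<delta>" and "fst I \<bullet> \<delta> = fst K \<bullet> \<delta> \<Longrightarrow> I = K"
proof -
  have fS: "finite S" using S finite_C by (rule finite_subset)
  have neg: "real (k J) * (fst J \<bullet> \<delta>) \<le> 0" if "J \<in> S" for J
    using interior[of J] that S by (auto simp: mult_nonneg_nonpos)
  have "fst I = (\<Sum>J\<in>S. real (k J) *\<^sub>R fst J)" by (simp add: I fst_sum)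
  then have eq: "fst I \<bullet> \<delta> = real (k K) * (fst K \<bullet> \<delta>) + (\<Sum>J\<in>S - {K}. real (k J) * (fst J \<bullet> \<delta>))"
    using K fS by (simp add: inner_sum_left inner_add_left sum.remove)
  have rest: "(\<Sum>J\<in>S - {K}. real (k J) * (fst J \<bullet> \<delta>)) \<le> 0"
    by (intro sum_nonpos) (auto intro: neg)
  have Kneg: "fst K \<bullet> \<delta> < 0" using K S interior by blast
  have le: "real (k K) * (fst K \<bullet> \<delta>) \<le> fst K \<bullet> \<delta>"
    using mult_right_mono_neg[of 1 "real (k K)" "fst K \<bullet> \<delta>"] Kneg K by simp
  show "fst I \<bullet> \<delta> \<le> fst K \<bullet> \<delta>" using eq rest le by linarith
  assume "fst I \<bullet> \<delta> = fst K \<bullet> \<delta>"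
  then have 1: "(\<Sum>J\<in>S - {K}. real (k J) * (fst J \<bullet> \<delta>)) = 0" and 2: "real (k K) * (fst K \<bullet> \<delta>) = fst K \<bullet> \<delta>"
    using eq rest le by linarith+
  have "k K = 1" using 2 Kneg by simp
  moreover have "k J = 0" if "J \<in> S - {K}" for J
  proof -
    have "(\<Sum>J\<in>S - {K}. - (real (k J) * (fst J \<bullet> \<delta>))) = 0" using 1 by (simp add: sum_negf)
    then have "- (real (k J) * (fst J \<bullet> \<delta>)) = 0"
      using that fS neg by (subst (asm) sum_nonneg_eq_0_iff) auto
    moreover have "fst J \<bullet> \<delta> < 0" using that S interior by blast
    ultimately show ?thesis by simp
  qed
  ultimately show "I = K"
    using K fS by (subst I) (simp add: sum.remove[of S K])
qed

text \<open>A row outside \<open>reduced\<close> is a combination of other rows, and by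
  \<open>combination_height\<close> every row used there is strictly lower. The induction counts the
  rows of smaller height.\<close>

lemma combination_reduced:
  assumes "I \<in> C"
  shows "nonneg_int_combination I reduced"
  using assms
proof (induction "card {K \<in> C. fst I \<bullet> \<delta> < fst K \<bullet> \<delta>}" arbitrary: I rule: less_induct)
  case less
  show ?case
  proof (cases "I \<in> reduced")
    case True
    then show ?thesis using finite_reduced by (rule nonneg_int_combination_mem[rotated])
  next
    case False
    then obtain k where k: "I = (\<Sum>J\<in>C - {I}. real (k J) *\<^sub>R J)"
      using less.prems unfolding reduced_def nonneg_int_combination_def by auto
    show ?thesis
    proof (rule nonneg_int_combination_trans[OF k])
      fix J assume J: "J \<in> C - {I}" "0 < k J"
      have "fst I \<bullet> \<delta> \<le> fst J \<bullet> \<delta>" "fst I \<bullet> \<delta> = fst J \<bullet> \<delta> \<Longrightarrow> I = J"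
        using combination_height[OF k _ J] by auto
      then have lt: "fst I \<bullet> \<delta> < fst J \<bullet> \<delta>" using J by force
      have "{K \<in> C. fst J \<bullet> \<delta> < fst K \<bullet> \<delta>} \<subset> {K \<in> C. fst I \<bullet> \<delta> < fst K \<bullet> \<delta>}"
        using J lt by auto
      then have "card {K \<in> C. fst J \<bullet> \<delta> < fst K \<bullet> \<delta>} < card {K \<in> C. fst I \<bullet> \<delta> < fst K \<bullet> \<delta>}"
        using finite_C by (intro psubset_card_mono) auto
      then show "nonneg_int_combination J reduced" using less.hyps[of J] J by simp
    qed
  qed
qed

lemma generate_reduced:
  assumes "integral_vec c" "\<And>z. z \<in> solution_set C \<Longrightarrow> c \<bullet> z \<le> c \<bullet> p"
  shows "nonneg_int_combination (c, c \<bullet> p) reduced"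
proof -
  obtain k where "(c, c \<bullet> p) = (\<Sum>J\<in>C. real (k J) *\<^sub>R J)"
    using generate[OF assms] unfolding nonneg_int_combination_def by auto
  then show ?thesis by (rule nonneg_int_combination_trans) (rule combination_reduced)
qed

lemma combination_le:
  assumes k: "I = (\<Sum>J\<in>S. real (k J) *\<^sub>R J)" and z: "z \<in> solution_set S"
  shows "fst I \<bullet> z \<le> snd I"
proof -
  have "fst I \<bullet> z = (\<Sum>J\<in>S. real (k J) * (fst J \<bullet> z))" unfolding k
    by (simp add: fst_sum inner_sum_left)
  also have "\<dots> \<le> (\<Sum>J\<in>S. real (k J) * snd J)"
    using z by (intro sum_mono mult_left_mono) (auto simp: solution_set_def split: prod.splits)
  also have "\<dots> = snd I" unfolding k by (simp add: snd_sum)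
  finally show ?thesis .
qed

lemma solution_set_reduced: "solution_set reduced = solution_set C"
proof
  show "solution_set C \<subseteq> solution_set reduced" using reduced_subset by (auto simp: solution_set_def)
  show "solution_set reduced \<subseteq> solution_set C"
  proof
    fix z assume z: "z \<in> solution_set reduced"
    have "fst I \<bullet> z \<le> snd I" if I: "I \<in> C" for I
    proof -
      obtain k where "I = (\<Sum>J\<in>reduced. real (k J) *\<^sub>R J)"
        using combination_reduced[OF I] unfolding nonneg_int_combination_def by auto
      then show ?thesis using z by (rule combination_le)
    qed
    then show "z \<in> solution_set C" by (auto simp: solution_set_def)
  qed
qed

text \<open>In a cone a maximizer \<open>x\<close> can be moved away from the apex to
  \<open>x + (x - p)\<close>. This gains nothing, so
  \<open>c \<bullet> x \<le> c \<bullet> p\<close>.\<close>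

lemma cone_max_at_apex:
  assumes "has_finite_max S c" "solution_set S = solution_set C" "z \<in> solution_set C"
  shows "c \<bullet> z \<le> c \<bullet> p"
proof -
  obtain x where x: "x \<in> solution_set C" and max: "\<And>z. z \<in> solution_set C \<Longrightarrow> c \<bullet> z \<le> c \<bullet> x"
    using assms unfolding has_finite_max_def by auto
  have "x + (x - p) \<in> solution_set C"
    unfolding solution_set_def
  proof (clarify)
    fix a b assume I: "(a, b) \<in> C"
    then have "a \<bullet> x \<le> b" "b = a \<bullet> p" using x tight[OF I] by (auto simp: solution_set_def)
    then show "a \<bullet> (x + (x - p)) \<le> b" unfolding inner_add_right inner_diff_right by linarith
  qed
  from max[OF this] have "c \<bullet> x \<le> c \<bullet> p" unfolding inner_add_right inner_diff_right by linarith
  then show ?thesis using max[OF assms(3)] by linarith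
qed

text \<open>Since all rows are tight at \<open>p\<close>, the dual objective is constant on feasible
  solutions. Every integral feasible dual vector is therefore optimal.\<close>

lemma dual_value_reduced:
  assumes "dual_feasible reduced c y"
  shows "dual_value reduced y = c \<bullet> p"
proof -
  have "c \<bullet> p = (\<Sum>I\<in>reduced. y I *\<^sub>R fst I) \<bullet> p" using assms by (simp add: dual_feasible_def)
  also have "\<dots> = (\<Sum>I\<in>reduced. snd I * y I)" unfolding inner_sum_left
    by (rule sum.cong) (use tight reduced_subset in auto)
  finally show ?thesis by (simp add: dual_value_def)
qed

lemma TDI_reduced: "TDI reduced"
  unfolding TDI_def
proof (intro allI impI, elim conjE)
  fix c :: "real^'n" assume c: "integral_vec c" "has_finite_max reduced c"
  obtain k where k: "(c, c \<bullet> p) = (\<Sum>J\<in>reduced. real (k J) *\<^sub>R J)"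
    using generate_reduced[OF c(1) cone_max_at_apex[OF c(2) solution_set_reduced]]
    unfolding nonneg_int_combination_def by auto
  have "c = fst (\<Sum>J\<in>reduced. real (k J) *\<^sub>R J)" by (simp flip: k)
  then have "dual_feasible reduced c (\<lambda>J. real (k J))" by (simp add: dual_feasible_def fst_sum)
  then have "dual_optimal reduced c (\<lambda>J. real (k J))"
    unfolding dual_optimal_def using dual_value_reduced by auto
  then show "\<exists>y. dual_optimal reduced c y \<and> (\<forall>I\<in>reduced. y I \<in> \<int>)" by auto
qed

text \<open>Total duality for the objective \<open>fst H\<close> writes \<open>H\<close> as an
  integral combination of rows of \<open>S\<close> tight at \<open>p\<close>. Each of these is in
  turn generated by \<open>C\<close>; if none of them were \<open>H\<close>, the expansion would
  avoid \<open>H\<close> and contradict its irreducibility.\<close>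

lemma reduced_subset_TDI:
  assumes S: "finite S" "\<And>I. I \<in> S \<Longrightarrow> integral_vec (fst I)"
    and sol: "solution_set S = solution_set C" and tdi: "TDI S"
  shows "reduced \<subseteq> S"
proof
  fix H assume H: "H \<in> reduced"
  then have HC: "H \<in> C" using reduced_subset by auto
  have max: "fst H \<bullet> z \<le> fst H \<bullet> p" if "z \<in> solution_set C" for z
    using that HC tight[OF HC] by (auto simp: solution_set_def)
  have pS: "p \<in> solution_set S" using apex_mem sol by simp
  have "has_finite_max S (fst H)"
    unfolding has_finite_max_def using apex_mem sol max by auto
  then obtain y where opt: "dual_optimal S (fst H) y" and int: "\<And>I. I \<in> S \<Longrightarrow> y I \<in> \<int>"
    using tdi integral_C[OF HC] unfolding TDI_def by blast
  have y0: "\<And>I. I \<in> S \<Longrightarrow> 0 \<le> y I" and comb: "(\<Sum>I\<in>S. y I *\<^sub>R fst I) = fst H"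
    using opt by (auto simp: dual_optimal_def dual_feasible_def)
  obtain y' where "dual_feasible S (fst H) y'" "dual_value S y' = fst H \<bullet> p"
    using farkas_at_point[OF S(1) pS, of "fst H"] max sol by auto
  then have "dual_value S y \<le> fst H \<bullet> p" using opt unfolding dual_optimal_def by metis
  then have le: "(\<Sum>I\<in>S. y I * snd I) \<le> (\<Sum>I\<in>S. y I * (fst I \<bullet> p))"
    unfolding comb[symmetric] dual_value_def by (simp add: inner_sum_left mult.commute)
  have row: "fst I \<bullet> p \<le> snd I" if "I \<in> S" for I
    using pS that by (auto simp: solution_set_def)
  \<comment> \<open>Complementary slackness: the terms are non-negative and their sum is at most 0,
    so \<open>y\<close> uses only rows tight at \<open>p\<close>.\<close>
  have "(\<Sum>I\<in>S. y I * (snd I - fst I \<bullet> p)) = 0"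
  proof (rule antisym)
    show "(\<Sum>I\<in>S. y I * (snd I - fst I \<bullet> p)) \<le> 0"
      using le by (simp add: right_diff_distrib sum_subtractf)
    show "0 \<le> (\<Sum>I\<in>S. y I * (snd I - fst I \<bullet> p))"
      using y0 row by (intro sum_nonneg mult_nonneg_nonneg) auto
  qed
  then have "\<forall>I\<in>S. y I * (snd I - fst I \<bullet> p) = 0"
    using y0 row S(1) by (subst (asm) sum_nonneg_eq_0_iff) auto
  then have tightS: "snd I = fst I \<bullet> p" if "I \<in> S" "y I \<noteq> 0" for I
    using that by auto
  define m where "m I = nat \<lfloor>y I\<rfloor>" for I
  have m: "real (m I) = y I" if "I \<in> S" for I
    using int[OF that] y0[OF that] by (auto simp: m_def elim!: Ints_cases)
  have "snd H = (\<Sum>I\<in>S. y I *\<^sub>R fst I) \<bullet> p" using comb tight[OF HC] by simp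
  also have "\<dots> = (\<Sum>I\<in>S. y I * snd I)" unfolding inner_sum_left
  proof (rule sum.cong[OF refl])
    fix I assume "I \<in> S"
    then show "(y I *\<^sub>R fst I) \<bullet> p = y I * snd I" using tightS[of I] by (cases "y I = 0") auto
  qed
  finally have "H = (\<Sum>I\<in>S. y I *\<^sub>R I)"
    using comb by (intro prod_eqI) (simp_all add: fst_sum snd_sum)
  then have Hm: "H = (\<Sum>I\<in>S. real (m I) *\<^sub>R I)" using m by simp
  have gen: "nonneg_int_combination I C" if I: "I \<in> S" "0 < m I" for I
  proof -
    have "y I \<noteq> 0" using m[OF I(1)] I(2) by auto
    then have t: "snd I = fst I \<bullet> p" using tightS I by auto
    have "nonneg_int_combination (fst I, fst I \<bullet> p) C"
    proof (rule generate[OF S(2)[OF I(1)]])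
      fix z assume "z \<in> solution_set C"
      then have "z \<in> solution_set S" using sol by simp
      then show "fst I \<bullet> z \<le> fst I \<bullet> p" using I(1) t by (force simp: solution_set_def)
    qed
    then show ?thesis by (simp flip: t)
  qed
  show "H \<in> S"
  proof (rule ccontr)
    assume "H \<notin> S"
    have "nonneg_int_combination H (C - {H})"
    proof (rule nonneg_int_combination_trans[OF Hm])
      fix I assume I: "I \<in> S" "0 < m I"
      obtain k where k: "I = (\<Sum>J\<in>C. real (k J) *\<^sub>R J)"
        using gen[OF I] unfolding nonneg_int_combination_def by auto
      have neg: "fst J \<bullet> \<delta> \<le> 0" if J: "J \<in> S" "0 < m J" for J
      proof -
        obtain k where "J = (\<Sum>K\<in>C. real (k K) *\<^sub>R K)"
          using gen[OF J] unfolding nonneg_int_combination_def by auto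
        then have "fst J \<bullet> \<delta> = (\<Sum>K\<in>C. real (k K) * (fst K \<bullet> \<delta>))"
          by (simp add: fst_sum inner_sum_left)
        also have "\<dots> \<le> 0" using interior by (intro sum_nonpos) (auto simp: mult_nonneg_nonpos less_imp_le)
        finally show ?thesis .
      qed
      have "fst H \<bullet> \<delta> = (\<Sum>J\<in>S. real (m J) * (fst J \<bullet> \<delta>))"
        by (subst Hm) (simp add: fst_sum inner_sum_left)
      also have "\<dots> = real (m I) * (fst I \<bullet> \<delta>) + (\<Sum>J\<in>S - {I}. real (m J) * (fst J \<bullet> \<delta>))"
        using I S(1) by (simp add: sum.remove)
      also have "(\<Sum>J\<in>S - {I}. real (m J) * (fst J \<bullet> \<delta>)) \<le> 0"
      proof (rule sum_nonpos)
        fix J assume "J \<in> S - {I}"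
        then show "real (m J) * (fst J \<bullet> \<delta>) \<le> 0"
          using neg[of J] by (cases "m J = 0") (auto simp: mult_nonneg_nonpos)
      qed
      also have "real (m I) * (fst I \<bullet> \<delta>) \<le> fst I \<bullet> \<delta>"
        using mult_right_mono_neg[of 1 "real (m I)" "fst I \<bullet> \<delta>"] neg[OF I] I by simp
      finally have HI: "fst H \<bullet> \<delta> \<le> fst I \<bullet> \<delta>" by simp
      \<comment> \<open>If \<open>H\<close> occurred in the expansion of \<open>I\<close>, it would
        be at most as high as \<open>I\<close>; by \<open>HI\<close> it is at least as high. Equal
        heights force \<open>I = H\<close>, but \<open>I\<close> lies in \<open>S\<close> and
        \<open>H\<close> does not.\<close>
      have "k H = 0"
      proof (rule ccontr)
        assume "k H \<noteq> 0"
        then have "fst I \<bullet> \<delta> \<le> fst H \<bullet> \<delta>" "fst I \<bullet> \<delta> = fst H \<bullet> \<delta> \<Longrightarrow> I = H"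
          using combination_height[OF k _ HC] by auto
        then have "I = H" using HI by auto
        then show False using I \<open>H \<notin> S\<close> by simp
      qed
      then have "I = (\<Sum>J\<in>C - {H}. real (k J) *\<^sub>R J)"
        using k HC finite_C by (simp add: sum.remove)
      then show "nonneg_int_combination I (C - {H})" unfolding nonneg_int_combination_def by auto
    qed
    then show False using H by (simp add: reduced_def)
  qed
qed

text \<open>\<open>reduced\<close> is itself TDI and is contained in every finite TDI system with
  integral rows for this cone, so it is the least such system and hence the only minimal
  one.\<close>

theorem unique_schrijver_system:
  "schrijver_system (solution_set C) S \<longleftrightarrow> S = reduced"
proof
  have int: "integral_vec (fst I)" if "I \<in> reduced" for I
    using that reduced_subset integral_C by blast
  show "schrijver_system (solution_set C) S" if S: "S = reduced"
    unfolding S schrijver_system_def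
  proof (intro conjI allI impI notI)
    fix T assume T: "T \<subset> reduced \<and> solution_set T = solution_set C" "TDI T"
    have "reduced \<subseteq> T"
      using T finite_reduced int by (intro reduced_subset_TDI) (auto intro: finite_subset)
    then show False using T by auto
  qed (use finite_reduced int solution_set_reduced TDI_reduced in auto)
  assume S: "schrijver_system (solution_set C) S"
  then have fin: "finite S" and intS: "\<And>I. I \<in> S \<Longrightarrow> integral_vec (fst I)"
    and sol: "solution_set S = solution_set C" and tdi: "TDI S"
    and min: "\<And>T. T \<subset> S \<Longrightarrow> solution_set T = solution_set C \<Longrightarrow> \<not> TDI T"
    unfolding schrijver_system_def by auto
  have "reduced \<subseteq> S" by (rule reduced_subset_TDI[OF fin intS sol tdi])
  then show "S = reduced"
    using min[OF _ solution_set_reduced] TDI_reduced by auto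
qed

end


section \<open>Integral flows on finite digraphs\<close>

definition net_outflow :: "('a::finite \<Rightarrow> 'a \<Rightarrow> nat) \<Rightarrow> 'a \<Rightarrow> int" where
  "net_outflow f u = (\<Sum>v\<in>UNIV. int (f u v)) - (\<Sum>v\<in>UNIV. int (f v u))"

lemma net_outflow_add:
  "net_outflow (\<lambda>u v. f u v + g u v) w = net_outflow f w + net_outflow g w"
  by (simp add: net_outflow_def sum.distrib)

lemma net_outflow_single:
  fixes a b :: "'a::finite"
  shows "net_outflow (\<lambda>u v. if u = a \<and> v = b then 1 else 0) w =
    of_bool (w = a) - of_bool (w = b)"
proof -
  have "(\<Sum>v\<in>UNIV. int (if w = a \<and> v = b then 1 else 0)) = (\<Sum>v\<in>UNIV. if v = b then of_bool (w = a) else 0)"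
    "(\<Sum>v\<in>UNIV. int (if v = a \<and> w = b then 1 else 0)) = (\<Sum>v\<in>UNIV. if v = a then of_bool (w = b) else 0)"
    by (rule sum.cong; simp)+
  then show ?thesis by (simp add: net_outflow_def)
qed

lemma unit_flow_rtranclp:
  fixes E :: "'a::finite \<Rightarrow> 'a \<Rightarrow> bool"
  assumes "E\<^sup>*\<^sup>* u v"
  shows "\<exists>f. (\<forall>x y. 0 < f x y \<longrightarrow> E x y) \<and> (\<forall>w. net_outflow f w = of_bool (w = u) - of_bool (w = v))"
  using assms
proof (induction rule: rtranclp_induct)
  case base
  show ?case by (intro exI[of _ "\<lambda>_ _. 0"]) (simp add: net_outflow_def)
next
  case (step y z)
  then obtain f where f: "\<forall>a b. 0 < f a b \<longrightarrow> E a b"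
    "\<forall>w. net_outflow f w = of_bool (w = u) - of_bool (w = y)" by auto
  let ?g = "\<lambda>a b. if a = y \<and> b = z then 1 else (0::nat)"
  show ?case
    using f step(2) by (intro exI[of _ "\<lambda>a b. f a b + ?g a b"]) (auto simp: net_outflow_add net_outflow_single)
qed

definition closed_under :: "('a \<Rightarrow> 'a \<Rightarrow> bool) \<Rightarrow> 'a set \<Rightarrow> bool" where
  "closed_under E S \<longleftrightarrow> (\<forall>x\<in>S. \<forall>y. E x y \<longrightarrow> y \<in> S)"

text \<open>A unit of supply at \<open>u\<close> can be routed to a vertex \<open>v\<close> of demand without violating the cut
  condition if \<open>v\<close> avoids the largest tight closed set \<open>M\<close> that does not contain \<open>u\<close>; the cut
  condition for the union of \<open>M\<close> and the vertices reachable from \<open>u\<close> provides such a \<open>v\<close>.\<close>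

theorem integral_flow_exists:
  fixes E :: "'a::finite \<Rightarrow> 'a \<Rightarrow> bool" and d :: "'a \<Rightarrow> int"
  assumes "\<And>S. closed_under E S \<Longrightarrow> sum d S \<le> 0" and "sum d UNIV = 0"
  shows "\<exists>f. (\<forall>x y. 0 < f x y \<longrightarrow> E x y) \<and> (\<forall>w. net_outflow f w = d w)"
  using assms
proof (induction "nat (\<Sum>w\<in>UNIV. \<bar>d w\<bar>)" arbitrary: d rule: less_induct)
  case less
  note cut = less.prems(1)
  show ?case
  proof (cases "\<exists>u. 0 < d u")
    case False
    then have "\<forall>w\<in>UNIV. - d w = 0"
      using less.prems(2) by (subst sum_nonneg_eq_0_iff[symmetric]) (auto simp: sum_negf not_less)
    then show ?thesis by (intro exI[of _ "\<lambda>_ _. 0"]) (simp add: net_outflow_def)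
  next
    case True
    then obtain u where u: "0 < d u" by auto
    define F where "F = {S. closed_under E S \<and> sum d S = 0 \<and> u \<notin> S}"
    define M where "M = \<Union>F"
    have union: "S \<union> T \<in> F" if "S \<in> F" "T \<in> F" for S T
    proof -
      have c: "closed_under E (S \<union> T)" "closed_under E (S \<inter> T)"
        using that by (auto simp: F_def closed_under_def)
      \<comment> \<open>Uncrossing: union and intersection both have sum at most 0 and together sum
        0, so both are tight.\<close>
      have "sum d (S \<union> T) + sum d (S \<inter> T) = sum d S + sum d T" by (rule sum.union_inter) auto
      then have "sum d (S \<union> T) = 0" using cut[OF c(1)] cut[OF c(2)] that by (simp add: F_def)
      then show ?thesis using c that by (auto simp: F_def)
    qed
    have MF: "M \<in> F"
    proof -
      have "\<Union>G \<in> F" if "finite G" "G \<subseteq> F" for G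
        using that
      proof (induction G)
        case empty
        show ?case by (simp add: F_def closed_under_def)
      next
        case (insert S G)
        then show ?case using union by simp
      qed
      then show ?thesis by (simp add: M_def)
    qed
    define R where "R = {v. E\<^sup>*\<^sup>* u v}"
    have "closed_under E (R \<union> M)" using MF
      by (auto simp: R_def F_def closed_under_def intro: rtranclp.rtrancl_into_rtrancl)
    then have "sum d (M \<union> (R - M)) \<le> 0" using cut[of "R \<union> M"] by (simp add: Un_commute)
    moreover have "sum d (M \<union> (R - M)) = sum d M + sum d (R - M)" by (rule sum.union_disjoint) auto
    ultimately have le: "sum d (R - M) \<le> 0" using MF by (simp add: F_def)
    have uR: "u \<in> R - M" using MF by (auto simp: R_def F_def)
    have "\<exists>v\<in>R - M. d v < 0"
    proof (rule ccontr)
      assume "\<not> ?thesis"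
      then have "0 < sum d (R - M)" using u uR by (intro sum_pos2[of _ u]) (auto simp: not_less)
      then show False using le by simp
    qed
    then obtain v where v: "v \<in> R - M" "d v < 0" by auto
    define d' where "d' w = d w - (of_bool (w = u) - of_bool (w = v))" for w
    have d'_sum: "sum d' S = sum d S - of_bool (u \<in> S) + of_bool (v \<in> S)" for S
      by (simp add: d'_def sum_subtractf sum.distrib of_bool_def)
    have uv: "u \<noteq> v" using u v by auto
    \<comment> \<open>Routing one unit lowers the absolute value by one at \<open>u\<close> and at
      \<open>v\<close>, because \<open>d\<close> has opposite signs there.\<close>
    have "(\<Sum>w\<in>UNIV. \<bar>d' w\<bar>) < (\<Sum>w\<in>UNIV. \<bar>d w\<bar>)"
      by (rule sum_strict_mono_ex1) (use u v uv in \<open>auto simp: d'_def intro!: bexI[of _ u]\<close>)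
    then have "nat (\<Sum>w\<in>UNIV. \<bar>d' w\<bar>) < nat (\<Sum>w\<in>UNIV. \<bar>d w\<bar>)"
      by (subst nat_less_eq_zless) (auto intro: sum_nonneg)
    \<comment> \<open>Only closed sets with \<open>v\<close> but not \<open>u\<close> gain a unit.
      Such a set is not in \<open>F\<close>, as \<open>v\<close> avoids \<open>M\<close>, so by
      integrality its sum was at most -1.\<close>
    moreover have "sum d' S \<le> 0" if S: "closed_under E S" for S
    proof (cases "v \<in> S \<and> u \<notin> S")
      case True
      then have "S \<notin> F" using v by (auto simp: M_def)
      then have "sum d S < 0" using cut[OF S] S True by (auto simp: F_def)
      then show ?thesis using True by (simp add: d'_sum)
    next
      case False
      then show ?thesis using cut[OF S] by (auto simp: d'_sum)
    qed
    moreover have "sum d' UNIV = 0" using less.prems(2) by (simp add: d'_sum)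
    ultimately obtain f where f: "\<forall>x y. 0 < f x y \<longrightarrow> E x y" "\<forall>w. net_outflow f w = d' w"
      using less.hyps[of d'] by auto
    obtain g where g: "\<forall>x y. 0 < g x y \<longrightarrow> E x y"
      "\<forall>w. net_outflow g w = of_bool (w = u) - of_bool (w = v)"
      using unit_flow_rtranclp[of E u v] v by (auto simp: R_def)
    show ?thesis
      using f g by (intro exI[of _ "\<lambda>x y. f x y + g x y"]) (auto simp: net_outflow_add d'_def)
  qed
qed

section \<open>Directed cycles, circulations and potentials\<close>

text \<open>\<open>directed_cycle\<close> with the arc relation as a parameter, so that it also
  applies to the support of a flow.\<close>

definition cycle_in :: "('a \<Rightarrow> 'a \<Rightarrow> bool) \<Rightarrow> 'a list \<Rightarrow> bool" where
  "cycle_in E C \<longleftrightarrow> C \<noteq> [] \<and> distinct C \<and> (\<forall>i<length C. E (cyc C i) (cyc C (i + 1)))"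

definition cycle_sum :: "('a \<Rightarrow> 'a \<Rightarrow> 'b::comm_monoid_add) \<Rightarrow> 'a list \<Rightarrow> 'b" where
  "cycle_sum w C = (\<Sum>i<length C. w (cyc C i) (cyc C (i + 1)))"

lemma cyc_nth: "i < length C \<Longrightarrow> cyc C i = C ! i"
  by (simp add: cyc_def)

lemma cyc_length: "cyc C (length C) = C ! 0"
  by (simp add: cyc_def)

lemma cycle_inI:
  assumes "C \<noteq> []" "distinct C" "successively E C" "E (last C) (hd C)"
  shows "cycle_in E C"
  unfolding cycle_in_def
proof (intro conjI allI impI)
  fix i assume i: "i < length C"
  show "E (cyc C i) (cyc C (i + 1))"
  proof (cases "Suc i = length C")
    case True
    then have "cyc C (i + 1) = hd C" "cyc C i = last C"
      using assms(1) i by (simp_all add: cyc_nth cyc_length last_conv_nth hd_conv_nth flip: True)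
        (simp_all add: True cyc_length)
    then show ?thesis using assms(4) by simp
  next
    case False
    then show ?thesis using assms(3) i by (simp add: cyc_nth successively_conv_nth)
  qed
qed (use assms in auto)

text \<open>Extending a longest path inside the support closes a cycle.\<close>

lemma cycle_in_exists:
  fixes E :: "'a::finite \<Rightarrow> 'a \<Rightarrow> bool"
  assumes "E a b" and ext: "\<And>x y. E x y \<Longrightarrow> \<exists>z. E y z"
  shows "\<exists>C. cycle_in E C"
proof -
  \<comment> \<open>The last vertex must have a successor, so that a longest path of this kind can
    be continued only by returning to itself.\<close>
  define P where "P xs \<longleftrightarrow> xs \<noteq> [] \<and> distinct xs \<and> successively E xs \<and> (\<exists>z. E (last xs) z)" for xs
  have P1: "P [a]" using assms by (auto simp: P_def)
  have bound: "length xs \<le> CARD('a)" if "P xs" for xs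
    using that by (metis P_def card_mono distinct_card finite_class.finite_UNIV subset_UNIV)
  obtain xs where xs: "P xs" and max: "\<And>ys. P ys \<Longrightarrow> length ys \<le> length xs"
    using ex_has_greatest_nat[of P "[a]" length "CARD('a) + 1"] P1 bound by (metis less_Suc_eq_le Suc_eq_plus1)
  obtain z where z: "E (last xs) z" using xs by (auto simp: P_def)
  have "z \<in> set xs"
  proof (rule ccontr)
    assume "z \<notin> set xs"
    then have "P (xs @ [z])" using xs z ext[OF z] by (auto simp: P_def successively_append_iff)
    from max[OF this] show False by simp
  qed
  then obtain as bs where "xs = as @ z # bs" by (meson split_list)
  then have "cycle_in E (z # bs)"
    using xs z by (intro cycle_inI) (auto simp: P_def successively_append_iff split: if_splits)
  then show ?thesis by auto
qed

text \<open>Conservation lets every arc of the support be continued, so the support contains a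
  cycle, and one unit along it can be removed; the induction is on the total flow. Weights are
  vectors so that whole inequalities can be summed along the cycles.\<close>

lemma circulation_decomposition:
  fixes f :: "'a::finite \<Rightarrow> 'a \<Rightarrow> nat" and w :: "'a \<Rightarrow> 'a \<Rightarrow> 'b::real_vector"
  assumes "\<And>x. net_outflow f x = 0"
  shows "\<exists>Cs. (\<forall>C\<in>set Cs. cycle_in (\<lambda>x y. 0 < f x y) C) \<and>
    (\<Sum>x\<in>UNIV. \<Sum>y\<in>UNIV. real (f x y) *\<^sub>R w x y) = (\<Sum>C\<leftarrow>Cs. cycle_sum w C)"
  using assms
proof (induction "\<Sum>x\<in>UNIV. \<Sum>y\<in>UNIV. f x y" arbitrary: f rule: less_induct)
  case less
  show ?case
  proof (cases "\<exists>a b. 0 < f a b")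
    case False
    then show ?thesis by (intro exI[of _ "[]"]) simp
  next
    case True
    then obtain a b where ab: "0 < f a b" by auto
    have "\<exists>z. 0 < f y z" if "0 < f x y" for x y
    proof (rule ccontr)
      assume "\<not> ?thesis"
      then have "(\<Sum>v\<in>UNIV. int (f v y)) = 0"
        using less.prems[of y] by (simp add: net_outflow_def)
      then have "\<forall>v\<in>UNIV. int (f v y) = 0" by (subst (asm) sum_nonneg_eq_0_iff) auto
      then show False using that by simp
    qed
    then obtain C where C: "cycle_in (\<lambda>x y. 0 < f x y) C"
      using cycle_in_exists[of "\<lambda>x y. 0 < f x y" a b] ab by blast
    then have ne: "C \<noteq> []" and dist: "distinct C" by (auto simp: cycle_in_def)
    define g where "g x y = (\<Sum>i<length C. if x = cyc C i \<and> y = cyc C (i + 1) then 1 else (0::nat))" for x y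
    have g_sum: "(\<Sum>x\<in>UNIV. \<Sum>y\<in>UNIV. real (g x y) *\<^sub>R w x y) = cycle_sum w C"
    proof -
      have "(\<Sum>x\<in>UNIV. \<Sum>y\<in>UNIV. real (g x y) *\<^sub>R w x y) =
        (\<Sum>x\<in>UNIV. \<Sum>y\<in>UNIV. \<Sum>i<length C. if y = cyc C (i + 1) then if x = cyc C i then w x y else 0 else 0)"
        unfolding g_def of_nat_sum scaleR_sum_left by (intro sum.cong refl) auto
      also have "\<dots> = (\<Sum>x\<in>UNIV. \<Sum>i<length C. \<Sum>y\<in>UNIV. if y = cyc C (i + 1) then if x = cyc C i then w x y else 0 else 0)"
        by (intro sum.cong refl sum.swap)
      also have "\<dots> = (\<Sum>i<length C. \<Sum>x\<in>UNIV. if x = cyc C i then w x (cyc C (i + 1)) else 0)"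
        by (subst sum.swap) simp
      also have "\<dots> = cycle_sum w C" by (simp add: cycle_sum_def)
      finally show ?thesis .
    qed
    have g_net: "net_outflow g x = 0" for x
    proof -
      have "net_outflow g x = (\<Sum>i<length C. net_outflow (\<lambda>u v. if u = cyc C i \<and> v = cyc C (i + 1) then 1 else 0) x)"
        unfolding net_outflow_def g_def of_nat_sum sum_subtractf by (simp add: sum.swap[of _ UNIV])
      also have "\<dots> = (\<Sum>i<length C. of_bool (x = cyc C i)) - (\<Sum>i<length C. of_bool (x = cyc C (i + 1)))"
        unfolding net_outflow_single sum_subtractf ..
      also have "\<dots> = 0"
        using sum_cyc_shift[where f = "\<lambda>i. of_bool (x = cyc C i) :: int" and C = C] ne
        by (simp add: cyc_def)
      finally show ?thesis .
    qed
    \<comment> \<open>A cycle with distinct vertices uses each arc at most once, and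
      \<open>f\<close> is at least 1 on the arcs of \<open>C\<close>.\<close>
    have g_le: "g x y \<le> f x y" for x y
    proof -
      let ?I = "{i \<in> {..<length C}. x = cyc C i \<and> y = cyc C (i + 1)}"
      have gI: "g x y = card ?I"
        unfolding g_def by (subst sum.inter_filter[symmetric]) simp_all
      have "i = j" if "i \<in> ?I" "j \<in> ?I" for i j
        using that dist by (auto simp: cyc_nth nth_eq_iff_index_eq)
      then have "card ?I \<le> Suc 0" by (subst card_le_Suc0_iff_eq) auto
      moreover have "0 < f x y" if "?I \<noteq> {}" using that C by (auto simp: cycle_in_def)
      ultimately show ?thesis
        unfolding gI by (metis Suc_leI card.empty le0 le_trans)
    qed
    define f' where "f' x y = f x y - g x y" for x y
    have f: "f x y = f' x y + g x y" for x y using g_le[of x y] by (simp add: f'_def)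
    have f_eq: "f = (\<lambda>x y. f' x y + g x y)" using f by blast
    have "net_outflow f' x = 0" for x
      using less.prems[of x] g_net[of x] net_outflow_add[of f' g x] by (simp flip: f_eq)
    moreover have "(\<Sum>x\<in>UNIV. \<Sum>y\<in>UNIV. f' x y) < (\<Sum>x\<in>UNIV. \<Sum>y\<in>UNIV. f x y)"
    proof -
      let ?u = "cyc C 0" and ?v = "cyc C (0 + 1)"
      have "g ?u ?v > 0" unfolding g_def using ne by (intro sum_pos2[of _ 0]) auto
      then have lt: "f' ?u ?v < f ?u ?v" using f[of ?u ?v] by simp
      have le: "f' x y \<le> f x y" for x y using f[of x y] by simp
      have "(\<Sum>y\<in>UNIV. f' ?u y) < (\<Sum>y\<in>UNIV. f ?u y)"
        using lt le by (intro sum_strict_mono_ex1) auto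
      moreover have "(\<Sum>y\<in>UNIV. f' x y) \<le> (\<Sum>y\<in>UNIV. f x y)" for x
        using le by (intro sum_mono)
      ultimately show ?thesis by (intro sum_strict_mono_ex1) auto
    qed
    ultimately obtain Cs where Cs: "\<forall>C\<in>set Cs. cycle_in (\<lambda>x y. 0 < f' x y) C"
      "(\<Sum>x\<in>UNIV. \<Sum>y\<in>UNIV. real (f' x y) *\<^sub>R w x y) = (\<Sum>C\<leftarrow>Cs. cycle_sum w C)"
      using less.hyps[of f'] by auto
    have "\<forall>D\<in>set (C # Cs). cycle_in (\<lambda>x y. 0 < f x y) D"
      using Cs(1) C f by (auto simp: cycle_in_def)
    moreover have "(\<Sum>x\<in>UNIV. \<Sum>y\<in>UNIV. real (f x y) *\<^sub>R w x y) = (\<Sum>D\<leftarrow>C # Cs. cycle_sum w D)"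
      using Cs(2) g_sum by (simp add: f scaleR_add_left sum.distrib)
    ultimately show ?thesis by blast
  qed
qed

section \<open>Path weights and potentials\<close>

fun path_sum :: "('a \<Rightarrow> 'a \<Rightarrow> 'b::comm_monoid_add) \<Rightarrow> 'a list \<Rightarrow> 'b" where
  "path_sum w (x # y # xs) = w x y + path_sum w (y # xs)"
| "path_sum w _ = 0"

lemma path_sum_append:
  "path_sum w (as @ z # bs) = path_sum w (as @ [z]) + path_sum w (z # bs)"
  by (induction w as rule: path_sum.induct) (auto simp: add.assoc neq_Nil_conv)

lemma path_sum_snoc:
  assumes "xs \<noteq> []"
  shows "path_sum w (xs @ [y]) = path_sum w xs + w (last xs) y"
proof -
  have "xs @ [y] = butlast xs @ last xs # [y]" using assms by simp
  then have "path_sum w (xs @ [y]) = path_sum w (butlast xs @ [last xs]) + path_sum w [last xs, y]"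
    using path_sum_append[of w "butlast xs" "last xs" "[y]"] by metis
  then show ?thesis using assms by simp
qed

lemma path_sum_conv_sum: "path_sum w xs = (\<Sum>i<length xs - 1. w (xs ! i) (xs ! Suc i))"
  by (induction w xs rule: path_sum.induct)
    (simp_all add: sum.lessThan_Suc_shift del: sum.lessThan_Suc)

lemma cycle_sum_conv_path_sum:
  assumes "C \<noteq> []"
  shows "cycle_sum w C = path_sum w C + w (last C) (hd C)"
proof -
  obtain n where n: "length C = Suc n" using assms by (cases C) auto
  have "cyc C (Suc n) = hd C" "C ! n = last C"
    using assms by (simp_all add: n[symmetric] cyc_length hd_conv_nth last_conv_nth) (simp add: n)
  then show ?thesis
    unfolding cycle_sum_def path_sum_conv_sum by (simp add: n cyc_nth)
qed

text \<open>The potential of \<open>x\<close> is the largest weight of a simple path ending at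
  \<open>x\<close>, with any starting vertex. Restricting to simple paths makes the maximum finite,
  and non-positive cycles make the restriction harmless.\<close>

lemma potential_exists:
  fixes w :: "'a::finite \<Rightarrow> 'a \<Rightarrow> real"
  assumes "\<And>C. cycle_in E C \<Longrightarrow> cycle_sum w C \<le> 0"
  shows "\<exists>l. \<forall>x y. E x y \<longrightarrow> l x + w x y \<le> l y"
proof -
  define P where "P x = {xs. xs \<noteq> [] \<and> distinct xs \<and> successively E xs \<and> last xs = x}" for x
  define l where "l x = Max (path_sum w ` P x)" for x
  have "P x \<subseteq> {xs. set xs \<subseteq> UNIV \<and> length xs \<le> CARD('a)}" for x
    by (auto simp: P_def) (metis card_mono distinct_card finite_class.finite_UNIV subset_UNIV)
  then have fin: "finite (P x)" for x
    by (rule finite_subset[OF _ finite_lists_length_le[OF finite_class.finite_UNIV]])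
  have le: "path_sum w xs \<le> l x" if "xs \<in> P x" for x xs
    using that fin by (auto simp: l_def)
  have "[x] \<in> P x" for x by (simp add: P_def)
  then have max: "\<exists>xs\<in>P x. l x = path_sum w xs" for x
    using Max_in[of "path_sum w ` P x"] fin unfolding l_def by blast
  have "l x + w x y \<le> l y" if E: "E x y" for x y
  proof -
    obtain xs where xs: "xs \<in> P x" "l x = path_sum w xs" using max by blast
    then have last: "last xs = x" and ne: "xs \<noteq> []" by (auto simp: P_def)
    show ?thesis
    proof (cases "y \<in> set xs")
      case False
      then have "xs @ [y] \<in> P y" using xs E by (auto simp: P_def successively_append_iff)
      from le[OF this] show ?thesis using xs last ne by (simp add: path_sum_snoc)
    next
      \<comment> \<open>The path already visits \<open>y\<close>: its part from \<open>y\<close> on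
        closes to a cycle of non-positive weight and is cut off.\<close>
      case True
      then obtain as bs where ab: "xs = as @ y # bs" by (meson split_list)
      have "as @ [y] \<in> P y" using xs by (auto simp: P_def ab successively_append_iff)
      then have 1: "path_sum w (as @ [y]) \<le> l y" by (rule le)
      have "cycle_in E (y # bs)"
        using xs E by (intro cycle_inI) (auto simp: P_def ab successively_append_iff split: if_splits)
      then have "path_sum w (y # bs) + w x y \<le> 0"
        using assms[of "y # bs"] last by (simp add: cycle_sum_conv_path_sum ab)
      then show ?thesis using 1 xs(2) path_sum_append[of w as y bs] by (simp add: ab)
    qed
  qed
  then show ?thesis by blast
qed


section \<open>Canonical representations\<close>

lemma finite_endpoints: "finite (endpoints (l :: 'n::finite \<Rightarrow> real) r)"
  by (simp add: endpoints_def)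

text \<open>Take a representation with fewest endpoints and replace each endpoint by the number of
  smaller ones. This keeps the order and fills an initial segment of the naturals.\<close>

lemma is_canonical_rep_exists:
  fixes prec :: "'n::finite \<Rightarrow> 'n \<Rightarrow> bool"
  assumes "interval_order prec"
  shows "\<exists>l r. is_canonical_rep prec l r"
proof -
  obtain l1 r1 where "interval_rep prec l1 r1" using assms by (auto simp: interval_order_def)
  then obtain q where q: "interval_rep prec (fst q) (snd q)"
    and qmin: "\<And>q'. interval_rep prec (fst q') (snd q') \<Longrightarrow>
      card (endpoints (fst q) (snd q)) \<le> card (endpoints (fst q') (snd q'))"
    using ex_has_least_nat[of "\<lambda>q. interval_rep prec (fst q) (snd q)" "(l1, r1)"
        "\<lambda>q. card (endpoints (fst q) (snd q))"] by auto
  define l r where "l = fst q" and "r = snd q"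
  have rep: "interval_rep prec l r" using q by (simp add: l_def r_def)
  have min: "card (endpoints l r) \<le> card (endpoints l' r')" if "interval_rep prec l' r'" for l' r'
    using qmin[of "(l', r')"] that by (simp add: l_def r_def)
  define E where "E = endpoints l r"
  have fE: "finite E" by (simp add: E_def finite_endpoints)
  define rk where "rk e = real (card {e' \<in> E. e' < e})" for e
  have mono: "rk a < rk b" if "a < b" "a \<in> E" for a b
  proof -
    have "{e' \<in> E. e' < a} \<subset> {e' \<in> E. e' < b}" using that by auto
    then have "card {e' \<in> E. e' < a} < card {e' \<in> E. e' < b}" using fE by (intro psubset_card_mono) auto
    then show ?thesis by (simp add: rk_def)
  qed
  have iff: "rk a < rk b \<longleftrightarrow> a < b" if "a \<in> E" "b \<in> E" for a b
    using mono[of a b] mono[of b a] that by (cases a b rule: linorder_cases) auto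
  have inE: "l x \<in> E" "r x \<in> E" for x by (auto simp: E_def endpoints_def)
  have rep': "interval_rep prec (rk \<circ> l) (rk \<circ> r)"
    using rep inE iff unfolding interval_rep_def by (simp add: not_less[symmetric])
  have ends: "endpoints (rk \<circ> l) (rk \<circ> r) = rk ` E"
    by (auto simp: E_def endpoints_def)
  have "inj_on rk E"
    by (rule inj_onI) (metis iff linorder_cases order_less_irrefl)
  then have card: "card (rk ` E) = card E" by (rule card_image)
  have "rk ` E \<subseteq> real ` {0..<card E}"
  proof clarify
    fix e assume "e \<in> E"
    then have "card {e' \<in> E. e' < e} < card E" using fE by (intro psubset_card_mono) auto
    then show "rk e \<in> real ` {0..<card E}" by (auto simp: rk_def)
  qed
  then have "rk ` E = real ` {0..<card E}"
    using card by (intro card_subset_eq) (auto simp: card_image)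
  then have "is_canonical_rep prec (rk \<circ> l) (rk \<circ> r)"
    unfolding is_canonical_rep_def ends card using rep' min by (auto simp: E_def)
  then show ?thesis by blast
qed

lemma canonical_rep_is_canonical:
  fixes prec :: "'n::finite \<Rightarrow> 'n \<Rightarrow> bool"
  assumes "interval_order prec"
  shows "is_canonical_rep prec (fst (canonical_rep prec)) (snd (canonical_rep prec))"
proof -
  have "\<exists>q. case q of (l, r) \<Rightarrow> is_canonical_rep prec l r" using is_canonical_rep_exists[OF assms] by auto
  from someI_ex[OF this] show ?thesis unfolding canonical_rep_def by (simp add: case_prod_unfold)
qed

text \<open>A right endpoint that is not a left endpoint could be moved down to the next smaller endpoint.\<close>

lemma canonical_right_is_left:
  fixes prec :: "'n::finite \<Rightarrow> 'n \<Rightarrow> bool"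
  assumes can: "is_canonical_rep prec l r"
  shows "range r \<subseteq> range l"
proof (rule ccontr)
  assume "\<not> ?thesis"
  then obtain a where k: "r a \<notin> range l" by auto
  define k where "k = r a"
  define D where "D = {e \<in> endpoints l r. e < k}"
  define r' where "r' y = (if r y = k then Max D else r y)" for y
  have rep: "interval_rep prec l r" using can by (simp add: is_canonical_rep_def)
  have le: "l x \<le> r x" and prec: "prec x y \<longleftrightarrow> r x < l y" for x y using rep by (auto simp: interval_rep_def)
  have nk: "l x \<noteq> k" for x using k unfolding k_def by (metis rangeI)
  have fD: "finite D" by (simp add: D_def finite_endpoints)
  have "l a \<in> D" using le[of a] nk[of a] by (auto simp: D_def k_def endpoints_def)
  then have MD: "Max D \<in> D" using fD by (intro Max_in) auto
  have D: "l x \<le> Max D \<longleftrightarrow> l x < k" for x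
    using MD fD by (auto simp: D_def endpoints_def intro!: Max_ge)
  have "interval_rep prec l r'"
    unfolding interval_rep_def
  proof (intro conjI allI)
    show "l x \<le> r' x" for x using le[of x] nk[of x] D[of x] by (auto simp: r'_def)
    show "prec x y \<longleftrightarrow> r' x < l y" for x y
      using D[of y] nk[of y] by (auto simp: r'_def prec not_le[symmetric])
  qed
  then have min: "card (endpoints l r) \<le> card (endpoints l r')" using can by (simp add: is_canonical_rep_def)
  have "endpoints l r' \<subseteq> endpoints l r - {k}"
    using MD nk by (auto simp: r'_def endpoints_def D_def)
  moreover have "k \<in> endpoints l r" by (simp add: k_def endpoints_def)
  ultimately have "endpoints l r' \<subset> endpoints l r" by blast
  then have "card (endpoints l r') < card (endpoints l r)" by (intro psubset_card_mono finite_endpoints)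
  then show False using min by simp
qed

text \<open>Mirror image of the previous argument: a left endpoint that is not a right endpoint
  could be moved up to the next larger endpoint, which saves one endpoint.\<close>

lemma canonical_left_is_right:
  fixes prec :: "'n::finite \<Rightarrow> 'n \<Rightarrow> bool"
  assumes can: "is_canonical_rep prec l r"
  shows "range l \<subseteq> range r"
proof (rule ccontr)
  assume "\<not> ?thesis"
  then obtain a where k: "l a \<notin> range r" by auto
  define k where "k = l a"
  define D where "D = {e \<in> endpoints l r. k < e}"
  define l' where "l' y = (if l y = k then Min D else l y)" for y
  have rep: "interval_rep prec l r" using can by (simp add: is_canonical_rep_def)
  have le: "l x \<le> r x" and prec: "prec x y \<longleftrightarrow> r x < l y" for x y using rep by (auto simp: interval_rep_def)
  have nk: "r x \<noteq> k" for x using k unfolding k_def by (metis rangeI)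
  have fD: "finite D" by (simp add: D_def finite_endpoints)
  have "r a \<in> D" using le[of a] nk[of a] by (auto simp: D_def k_def endpoints_def)
  then have MD: "Min D \<in> D" using fD by (intro Min_in) auto
  have D: "Min D \<le> r x \<longleftrightarrow> k < r x" for x
    using MD fD by (auto simp: D_def endpoints_def intro!: Min_le)
  have "interval_rep prec l' r"
    unfolding interval_rep_def
  proof (intro conjI allI)
    show "l' x \<le> r x" for x using le[of x] nk[of x] D[of x] by (auto simp: l'_def)
    show "prec x y \<longleftrightarrow> r x < l' y" for x y
      using D[of x] nk[of x] by (auto simp: l'_def prec not_le[symmetric])
  qed
  then have min: "card (endpoints l r) \<le> card (endpoints l' r)" using can by (simp add: is_canonical_rep_def)
  have "endpoints l' r \<subseteq> endpoints l r - {k}"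
    using MD nk by (auto simp: l'_def endpoints_def D_def)
  moreover have "k \<in> endpoints l r" by (simp add: k_def endpoints_def)
  ultimately have "endpoints l' r \<subset> endpoints l r" by blast
  then have "card (endpoints l' r) < card (endpoints l r)" by (intro psubset_card_mono finite_endpoints)
  then show False using min by simp
qed

section \<open>Slack zero constraints determine all representations\<close>

locale canonical_interval_rep =
  fixes prec :: "'n::finite \<Rightarrow> 'n \<Rightarrow> bool" and l0 r0 :: "'n \<Rightarrow> real"
  assumes can: "canonical_rep prec = (l0, r0)" and is_can: "is_canonical_rep prec l0 r0"
begin

lemma l0_le_r0: "l0 x \<le> r0 x" and prec_iff: "prec x y \<longleftrightarrow> r0 x < l0 y"
  using is_can by (auto simp: is_canonical_rep_def interval_rep_def)

text \<open>Every grid point is both a left and a right endpoint, so chains of slack zero pairs can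
  pass through it.\<close>

lemma range_endpoints:
  "range l0 = real ` {0..<card (endpoints l0 r0)}" "range r0 = real ` {0..<card (endpoints l0 r0)}"
proof -
  have eq: "range l0 = range r0"
    using canonical_right_is_left[OF is_can] canonical_left_is_right[OF is_can] by (rule equalityI[rotated])
  then have "endpoints l0 r0 = range r0" by (simp add: endpoints_def)
  moreover have "endpoints l0 r0 = real ` {0..<card (endpoints l0 r0)}"
    using is_can unfolding is_canonical_rep_def by (elim conjE)
  ultimately show "range r0 = real ` {0..<card (endpoints l0 r0)}" by (rule trans[OF sym])
  then show "range l0 = real ` {0..<card (endpoints l0 r0)}" by (rule trans[OF eq])
qed

lemma blue_arc_iff: "blue_arc prec x y \<longleftrightarrow> l0 y = r0 x + 1"
  using l0_le_r0[of x] l0_le_r0[of y]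
  by (auto simp: blue_arc_def cover_pair_def slack_zero_pair_def slack_def can prec_iff)

text \<open>Incomparable pairs and loops have the same slack formula \<open>r0 y - l0 x\<close>, so
  loops need no separate case later.\<close>

lemma red_arc_iff: "red_arc prec x y \<longleftrightarrow> r0 y = l0 x"
  using l0_le_r0[of x] l0_le_r0[of y]
  by (auto simp: red_arc_def sharp_pair_def slack_zero_pair_def slack_def can incomparable_def prec_iff)

text \<open>The endpoints may be real: a solution of the cycle inequalities first yields real
  endpoints, which are rounded afterwards.\<close>

definition slack_zero_feasible :: "('n \<Rightarrow> real) \<Rightarrow> ('n \<Rightarrow> real) \<Rightarrow> bool" where
  "slack_zero_feasible l r \<longleftrightarrow>
     (\<forall>x y. blue_arc prec x y \<longrightarrow> r x + 1 \<le> l y) \<and> (\<forall>x y. red_arc prec x y \<longrightarrow> l x \<le> r y)"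

text \<open>Since every point between \<open>r0 x\<close> and \<open>l0 y\<close> is both a left and a right endpoint, the other
  constraints follow by chaining slack zero constraints from one point to the next.\<close>

lemma slack_zero_feasible_chain:
  assumes f: "slack_zero_feasible l r" and "r0 x + real (Suc n) = l0 y"
  shows "r x + 1 \<le> l y"
  using assms(2)
proof (induction n arbitrary: x)
  case 0
  then show ?case using f by (simp add: slack_zero_feasible_def blue_arc_iff)
next
  case (Suc n)
  let ?m = "card (endpoints l0 r0)"
  have "r0 x \<in> range r0" "l0 y \<in> range l0" by auto
  then obtain i j where "r0 x = real i" "l0 y = real j" "j < ?m"
    unfolding range_endpoints by auto
  then have "r0 x + 1 \<in> real ` {0..<?m}"
    using Suc.prems by (intro image_eqI[of _ _ "Suc i"]) auto
  then have "r0 x + 1 \<in> range l0" "r0 x + 1 \<in> range r0" unfolding range_endpoints by auto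
  then obtain z w where zw: "l0 z = r0 x + 1" "r0 w = r0 x + 1" by (metis imageE)
  then have "r x + 1 \<le> l z" "l z \<le> r w"
    using f by (auto simp: slack_zero_feasible_def blue_arc_iff red_arc_iff)
  moreover have "r w + 1 \<le> l y" using Suc.prems zw by (intro Suc.IH) simp
  ultimately show ?case by linarith
qed

lemma slack_zero_feasible_less:
  assumes "slack_zero_feasible l r" "r0 x < l0 y"
  shows "r x + 1 \<le> l y"
proof -
  have "r0 x \<in> range r0" "l0 y \<in> range l0" by auto
  then obtain i j where ij: "r0 x = real i" "l0 y = real j" unfolding range_endpoints by auto
  then have "i < j" using assms(2) by simp
  then obtain n where "j = i + Suc n" using less_iff_Suc_add by auto
  then show ?thesis using slack_zero_feasible_chain[OF assms(1), of x n y] ij by simp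
qed

lemma slack_zero_feasible_le:
  assumes f: "slack_zero_feasible l r" and "l0 x \<le> r0 y"
  shows "l x \<le> r y"
proof (cases "l0 x = r0 y")
  case True
  then show ?thesis using f by (auto simp: slack_zero_feasible_def red_arc_iff)
next
  case False
  \<comment> \<open>Pass through an interval ending at \<open>l0 x\<close> and one beginning at
    \<open>r0 y\<close>, which reduces the claim to the strict case.\<close>
  have "l0 x \<in> range r0" "r0 y \<in> range l0" using range_endpoints by blast+
  then obtain z w where zw: "r0 z = l0 x" "l0 w = r0 y" by (metis imageE)
  then have "l x \<le> r z" "l w \<le> r y" using f by (auto simp: slack_zero_feasible_def red_arc_iff)
  moreover have "r z + 1 \<le> l w" using False assms(2) zw by (intro slack_zero_feasible_less[OF f]) simp
  ultimately show ?thesis by linarith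
qed

text \<open>In the canonical representation either \<open>r0 x < l0 y\<close> or
  \<open>l0 y \<le> r0 x\<close>, and the chained constraints transfer either comparison to
  \<open>l\<close> and \<open>r\<close>.\<close>

lemma slack_zero_feasible_interval_rep:
  assumes "slack_zero_feasible l r"
  shows "interval_rep prec l r"
  unfolding interval_rep_def
proof (intro conjI allI)
  show "l x \<le> r x" for x by (rule slack_zero_feasible_le[OF assms l0_le_r0])
  show "prec x y \<longleftrightarrow> r x < l y" for x y
    using slack_zero_feasible_less[OF assms, of x y] slack_zero_feasible_le[OF assms, of y x]
    by (cases "prec x y") (auto simp: prec_iff)
qed

text \<open>Between integers the strict inequality of a cover pair leaves a gap of at least
  1.\<close>

lemma interval_rep_slack_zero_feasible:
  assumes "interval_rep prec l r" "range l \<subseteq> \<int>" "range r \<subseteq> \<int>"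
  shows "slack_zero_feasible l r"
  unfolding slack_zero_feasible_def
proof (intro conjI allI impI)
  fix x y
  assume "blue_arc prec x y"
  then have "r x < l y" using assms(1) by (simp add: blue_arc_def cover_pair_def interval_rep_def)
  moreover obtain i j where "r x = of_int i" "l y = of_int j"
    using assms(2,3) by (meson Ints_cases range_subsetD)
  ultimately show "r x + 1 \<le> l y" by simp
next
  fix x y
  assume "red_arc prec x y"
  then have "\<not> prec y x" using l0_le_r0[of x] by (simp add: red_arc_iff prec_iff)
  then show "l x \<le> r y" using assms(1) by (simp add: interval_rep_def not_less)
qed

section \<open>Cycle inequalities and the length polyhedron\<close>

text \<open>With \<open>t = 1\<close> this is the defect of the cycle inequality, with \<open>t = 0\<close> its homogeneous part.\<close>

lemma cycle_ineq_telescope: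
  assumes C: "directed_cycle prec C"
  shows "fst (cycle_ineq prec C) \<bullet> (\<chi> x. r x - l x) - t * snd (cycle_ineq prec C) =
    cycle_sum (\<lambda>x y. if blue_arc prec x y then r x + t - l y else l x - r y) C"
proof -
  let ?L = "(\<chi> x. l x) :: real^'n" and ?P = "(\<chi> x. r x - l x) :: real^'n"
  \<comment> \<open>This linear functional evaluates a weight at left endpoints \<open>l\<close> and
    lengths \<open>r - l\<close>, with the right-hand side scaled by \<open>t\<close>. Around a
    cycle the coefficients of \<open>l\<close> cancel.\<close>
  define \<phi> where "\<phi> = (\<lambda>q :: (real^'n) \<times> (real^'n) \<times> real. fst q \<bullet> ?L + fst (snd q) \<bullet> ?P - t * snd (snd q))"
  have arc: "\<phi> (arc_weight prec x y) = (if blue_arc prec x y then r x + t - l y else l x - r y)" for x y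
    by (simp add: \<phi>_def arc_weight_def inner_diff_left inner_axis')
  have lin: "\<phi> (\<Sum>i\<in>A. g i) = (\<Sum>i\<in>A. \<phi> (g i))" for A :: "nat set" and g
    by (simp add: \<phi>_def fst_sum snd_sum inner_sum_left sum.distrib sum_subtractf sum_distrib_left)
  have "fst (cycle_ineq prec C) \<bullet> ?P - t * snd (cycle_ineq prec C) = \<phi> (0, cycle_ineq prec C)"
    by (simp add: \<phi>_def)
  also have "\<dots> = (\<Sum>i<length C. \<phi> (arc_weight prec (cyc C i) (cyc C (i + 1))))"
    by (simp only: sum_arc_weights[OF C, symmetric] lin)
  finally show ?thesis unfolding arc cycle_sum_def .
qed

lemma directed_cycle_iff: "directed_cycle prec C \<longleftrightarrow> cycle_in (key_arc prec) C"
  by (simp add: directed_cycle_def cycle_in_def)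

lemma cycle_sum_nonpos:
  fixes w :: "'a \<Rightarrow> 'a \<Rightarrow> real"
  assumes "cycle_in E C" "\<And>x y. E x y \<Longrightarrow> w x y \<le> 0"
  shows "cycle_sum w C \<le> 0"
  unfolding cycle_sum_def using assms by (intro sum_nonpos) (auto simp: cycle_in_def)

lemma slack_zero_feasible_solution:
  assumes "slack_zero_feasible l r"
  shows "(\<chi> x. r x - l x) \<in> solution_set (cycle_system prec)"
proof -
  have "fst (cycle_ineq prec C) \<bullet> (\<chi> x. r x - l x) \<le> snd (cycle_ineq prec C)"
    if C: "directed_cycle prec C" for C
  proof -
    have "cycle_sum (\<lambda>x y. if blue_arc prec x y then r x + 1 - l y else l x - r y) C \<le> 0"
      by (rule cycle_sum_nonpos[OF C[unfolded directed_cycle_iff]])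
        (use assms in \<open>auto simp: slack_zero_feasible_def key_arc_def\<close>)
    then show ?thesis using cycle_ineq_telescope[OF C, of r l 1] by simp
  qed
  then show ?thesis unfolding mem_solution_set cycle_system_def by blast
qed

lemma convex_solution_set: "convex (solution_set S)"
proof -
  have "solution_set S = (\<Inter>I\<in>S. {x. fst I \<bullet> x \<le> snd I})" by (rule set_eqI) (simp add: mem_solution_set)
  then show ?thesis by (auto intro: convex_INT convex_halfspace_le)
qed

lemma length_polyhedron_subset: "length_polyhedron prec \<subseteq> solution_set (cycle_system prec)"
  unfolding length_polyhedron_def
  by (rule hull_minimal) (auto simp: convex_solution_set intro!: slack_zero_feasible_solution
      interval_rep_slack_zero_feasible)

text \<open>The cycle inequalities say that no cycle of the key graph has positive weight once the
  lengths are fixed. A potential for these weights supplies the left endpoints.\<close>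

lemma solution_slack_zero_feasible:
  assumes "\<rho> \<in> solution_set (cycle_system prec)"
  shows "\<exists>l. slack_zero_feasible l (\<lambda>x. l x + \<rho> $ x)"
proof -
  \<comment> \<open>The terms of \<open>cycle_ineq_telescope\<close> for left endpoints 0 and right
    endpoints \<rho>, so that the lengths are \<rho>; the zeros keep its shape.\<close>
  let ?w = "\<lambda>x y. if blue_arc prec x y then \<rho> $ x + 1 - 0 else 0 - \<rho> $ y"
  have "cycle_sum ?w C \<le> 0" if "cycle_in (key_arc prec) C" for C
  proof -
    have C: "directed_cycle prec C" using that by (simp add: directed_cycle_iff)
    then have "cycle_ineq prec C \<in> cycle_system prec" unfolding cycle_system_def by blast
    then have "fst (cycle_ineq prec C) \<bullet> \<rho> \<le> snd (cycle_ineq prec C)"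
      using assms unfolding mem_solution_set by blast
    then show ?thesis using cycle_ineq_telescope[OF C, of "\<lambda>x. \<rho> $ x" "\<lambda>_. 0" 1] by simp
  qed
  then obtain l where l: "\<And>x y. key_arc prec x y \<Longrightarrow> l x + ?w x y \<le> l y"
    using potential_exists[of "key_arc prec" ?w] by blast
  have "slack_zero_feasible l (\<lambda>x. l x + \<rho> $ x)"
    unfolding slack_zero_feasible_def
  proof (intro conjI allI impI)
    fix x y
    show "l x + \<rho> $ x + 1 \<le> l y" if "blue_arc prec x y" using l[of x y] that by (simp add: key_arc_def)
    show "l x \<le> l y + \<rho> $ y" if "red_arc prec x y"
      using l[of x y] that not_blue_and_red[of prec x y] by (auto simp: key_arc_def)
  qed
  then show ?thesis by blast
qed

text \<open>Floors are monotone and commute with adding 1, so one common shift of all endpoints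
  before rounding respects both kinds of arcs.\<close>

lemma slack_zero_feasible_floor:
  assumes "slack_zero_feasible l r"
  shows "slack_zero_feasible (\<lambda>x. of_int \<lfloor>l x + \<theta>\<rfloor>) (\<lambda>x. of_int \<lfloor>r x + \<theta>\<rfloor>)"
  unfolding slack_zero_feasible_def
proof (intro conjI allI impI)
  fix x y
  assume "blue_arc prec x y"
  then have "r x + \<theta> + 1 \<le> l y + \<theta>" using assms by (simp add: slack_zero_feasible_def)
  then have "\<lfloor>r x + \<theta>\<rfloor> + 1 \<le> \<lfloor>l y + \<theta>\<rfloor>" using floor_mono[of "r x + \<theta> + 1" "l y + \<theta>"] by simp
  then show "real_of_int \<lfloor>r x + \<theta>\<rfloor> + 1 \<le> real_of_int \<lfloor>l y + \<theta>\<rfloor>" by linarith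
next
  fix x y
  assume "red_arc prec x y"
  then show "real_of_int \<lfloor>l x + \<theta>\<rfloor> \<le> real_of_int \<lfloor>r y + \<theta>\<rfloor>"
    using assms by (simp add: slack_zero_feasible_def floor_mono)
qed

end

section \<open>Simultaneous rounding and averaging\<close>

text \<open>This evaluates the mean of the rounded endpoints over \<open>N\<close> equally spaced
  shifts. Writing each floor as an integer division by \<open>N\<close> reduces it to a sum over
  consecutive integers.\<close>

lemma hermite_identity:
  assumes "0 < N"
  shows "(\<Sum>j<N. \<lfloor>x + real j / real N\<rfloor>) = \<lfloor>real N * x\<rfloor>"
proof -
  \<comment> \<open>Raising \<open>q\<close> by one shifts the window of summands, so only its two
    end terms matter, and they differ by 1.\<close>
  have shift: "(\<Sum>j<N. (q + 1 + int j) div int N) = (\<Sum>j<N. (q + int j) div int N) + 1" for q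
  proof -
    have "(\<Sum>j<N. (q + int (Suc j)) div int N) - (\<Sum>j<N. (q + int j) div int N) =
        (q + int N) div int N - (q + int 0) div int N"
      using sum_lessThan_telescope[of "\<lambda>j. (q + int j) div int N" N] by (simp only: sum_subtractf)
    also have "\<dots> = 1" using assms by simp
    finally show ?thesis by (simp add: algebra_simps)
  qed
  have sum: "(\<Sum>j<N. (q + int j) div int N) = q" for q
  proof (induction q rule: int_induct[of _ 0])
    case base
    show ?case by simp
  next
    case (step1 i)
    then show ?case using shift[of i] by simp
  next
    case (step2 i)
    then show ?case using shift[of "i - 1"] by simp
  qed
  have "\<lfloor>x + real j / real N\<rfloor> = (\<lfloor>real N * x\<rfloor> + int j) div int N" for j
  proof -
    have "x + real j / real N = (real N * x + real j) / real_of_int (int N)"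
      using assms by (simp add: field_simps)
    then have "\<lfloor>x + real j / real N\<rfloor> = \<lfloor>real N * x + real j\<rfloor> div int N"
      by (simp only: floor_divide_real_eq_div of_nat_0_le_iff)
    also have "\<lfloor>real N * x + real j\<rfloor> = \<lfloor>real N * x\<rfloor> + int j"
      using floor_add_int[of "real N * x" "int j"] by simp
    finally show ?thesis .
  qed
  then show ?thesis by (simp add: sum)
qed

lemma floor_multiple_tendsto: "(\<lambda>N. of_int \<lfloor>real (Suc N) * x\<rfloor> / real (Suc N)) \<longlonglongrightarrow> x"
proof (rule tendsto_sandwich[OF always_eventually always_eventually])
  show "\<forall>N. x - 1 / real (Suc N) \<le> of_int \<lfloor>real (Suc N) * x\<rfloor> / real (Suc N)"
  proof
    fix N
    have "x - 1 / real (Suc N) = (real (Suc N) * x - 1) / real (Suc N)" by (simp add: diff_divide_distrib)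
    also have "real (Suc N) * x - 1 \<le> of_int \<lfloor>real (Suc N) * x\<rfloor>" by linarith
    finally show "x - 1 / real (Suc N) \<le> of_int \<lfloor>real (Suc N) * x\<rfloor> / real (Suc N)"
      by (simp add: divide_right_mono)
  qed
  show "\<forall>N. of_int \<lfloor>real (Suc N) * x\<rfloor> / real (Suc N) \<le> x"
  proof
    fix N
    show "of_int \<lfloor>real (Suc N) * x\<rfloor> / real (Suc N) \<le> x"
      by (simp add: pos_divide_le_eq mult.commute del: of_nat_Suc)
  qed
  show "(\<lambda>N. x - 1 / real (Suc N)) \<longlonglongrightarrow> x"
    using tendsto_diff[OF tendsto_const LIMSEQ_inverse_real_of_nat, of x] by (simp add: inverse_eq_divide)
qed simp

text \<open>Averaging the simultaneous roundings over \<open>\<theta> = 0, 1/N, \<dots>, (N-1)/N\<close> recovers \<open>r - l\<close>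
  in the limit, and only finitely many roundings occur.\<close>

lemma mean_of_floors_in_hull:
  fixes l r :: "'n::finite \<Rightarrow> real"
  shows "(\<chi> x. r x - l x) \<in> convex hull
    ((\<lambda>\<theta>. \<chi> x. of_int \<lfloor>r x + \<theta>\<rfloor> - of_int \<lfloor>l x + \<theta>\<rfloor>) ` {0..<1})" (is "_ \<in> convex hull (?v ` _)")
proof -
  let ?V = "?v ` {0..<1}"
  have fl: "\<lfloor>y + \<theta>\<rfloor> = \<lfloor>y\<rfloor> + of_bool (\<lfloor>y + \<theta>\<rfloor> \<noteq> \<lfloor>y\<rfloor>)" if "\<theta> \<in> {0..<1}" for y \<theta> :: real
  proof -
    have "\<lfloor>y\<rfloor> \<le> \<lfloor>y + \<theta>\<rfloor>" "\<lfloor>y + \<theta>\<rfloor> \<le> \<lfloor>y\<rfloor> + 1" using that by (auto simp: floor_mono) linarith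
    then show ?thesis by auto
  qed
  \<comment> \<open>A shift below 1 raises each floor by 0 or 1, so a rounding is encoded by the
    sets of right and left endpoints that go up. Finitely many codes make the hull closed.\<close>
  define h where "h = (\<lambda>(A, B). (\<chi> x. of_int (\<lfloor>r x\<rfloor> + of_bool (x \<in> A)) - of_int (\<lfloor>l x\<rfloor> + of_bool (x \<in> B))) :: real^'n)"
  have "?V \<subseteq> range h"
  proof clarify
    fix \<theta> :: real assume "\<theta> \<in> {0..<1}"
    then have "?v \<theta> = h ({x. \<lfloor>r x + \<theta>\<rfloor> \<noteq> \<lfloor>r x\<rfloor>}, {x. \<lfloor>l x + \<theta>\<rfloor> \<noteq> \<lfloor>l x\<rfloor>})"
      unfolding h_def by (simp only: case_prod_conv mem_Collect_eq fl[symmetric])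
    then show "?v \<theta> \<in> range h" by blast
  qed
  then have "finite ?V" by (rule finite_subset) simp
  then have closed: "closed (convex hull ?V)"
    by (intro compact_imp_closed compact_convex_hull finite_imp_compact)
  define a where "a N = (\<Sum>j<Suc N. (1 / real (Suc N)) *\<^sub>R ?v (real j / real (Suc N)))" for N
  have "a N \<in> convex hull ?V" for N
    unfolding a_def
  proof (rule convex_sum)
    fix j assume "j \<in> {..<Suc N}"
    then show "?v (real j / real (Suc N)) \<in> convex hull ?V"
      by (intro hull_inc imageI) (auto simp: field_simps)
  qed auto
  moreover have "a \<longlonglongrightarrow> (\<chi> x. r x - l x)"
  proof (rule vec_tendstoI)
    fix x
    have "a N $ x = of_int \<lfloor>real (Suc N) * r x\<rfloor> / real (Suc N) - of_int \<lfloor>real (Suc N) * l x\<rfloor> / real (Suc N)" for N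
    proof -
      have "a N $ x = (\<Sum>j<Suc N. (1 / real (Suc N)) * (of_int \<lfloor>r x + real j / real (Suc N)\<rfloor> - of_int \<lfloor>l x + real j / real (Suc N)\<rfloor>))"
        by (simp only: a_def sum_component vector_scaleR_component vec_lambda_beta real_scaleR_def)
      also have "\<dots> = (1 / real (Suc N)) * (of_int (\<Sum>j<Suc N. \<lfloor>r x + real j / real (Suc N)\<rfloor>) -
          of_int (\<Sum>j<Suc N. \<lfloor>l x + real j / real (Suc N)\<rfloor>))"
        by (simp only: of_int_sum sum_subtractf[symmetric] sum_distrib_left)
      finally show ?thesis unfolding hermite_identity[OF zero_less_Suc] by (simp add: diff_divide_distrib)
    qed
    then show "(\<lambda>N. a N $ x) \<longlonglongrightarrow> (\<chi> x. r x - l x) $ x"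
      using tendsto_diff[OF floor_multiple_tendsto[of "r x"] floor_multiple_tendsto[of "l x"]] by simp
  qed
  ultimately show ?thesis by (rule closed_sequentially[OF closed, rotated -1, rotated])
qed

context canonical_interval_rep
begin

theorem solution_set_cycle_system: "solution_set (cycle_system prec) = length_polyhedron prec"
proof
  show "length_polyhedron prec \<subseteq> solution_set (cycle_system prec)" by (rule length_polyhedron_subset)
  show "solution_set (cycle_system prec) \<subseteq> length_polyhedron prec"
  proof
    fix \<rho> assume "\<rho> \<in> solution_set (cycle_system prec)"
    then obtain l where l: "slack_zero_feasible l (\<lambda>x. l x + \<rho> $ x)" using solution_slack_zero_feasible by blast
    define r where "r x = l x + \<rho> $ x" for x
    have feas: "slack_zero_feasible l r" using l by (simp add: r_def[abs_def])
    let ?v = "\<lambda>\<theta>. (\<chi> x. of_int \<lfloor>r x + \<theta>\<rfloor> - of_int \<lfloor>l x + \<theta>\<rfloor>) :: real^'n"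
    have "(\<chi> x. r x - l x) \<in> convex hull (?v ` {0..<1})" by (rule mean_of_floors_in_hull)
    moreover have "?v ` {0..<1} \<subseteq>
        {(\<chi> x. r x - l x) | l r. interval_rep prec l r \<and> range l \<subseteq> \<int> \<and> range r \<subseteq> \<int>}"
    proof clarify
      fix \<theta> :: real
      show "\<exists>l' r'. ?v \<theta> = (\<chi> x. r' x - l' x) \<and> interval_rep prec l' r' \<and> range l' \<subseteq> \<int> \<and> range r' \<subseteq> \<int>"
        by (rule exI[of _ "\<lambda>x. of_int \<lfloor>l x + \<theta>\<rfloor>"], rule exI[of _ "\<lambda>x. of_int \<lfloor>r x + \<theta>\<rfloor>"])
          (auto intro: slack_zero_feasible_interval_rep slack_zero_feasible_floor feas)
    qed
    ultimately have "(\<chi> x. r x - l x) \<in> length_polyhedron prec"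
      unfolding length_polyhedron_def using hull_mono by blast
    moreover have "(\<chi> x. r x - l x) = \<rho>" by (simp add: r_def vec_eq_iff)
    ultimately show "\<rho> \<in> length_polyhedron prec" by simp
  qed
qed

section \<open>The apex and the generation of its normal cone\<close>

definition apex :: "real^'n" where "apex = (\<chi> x. r0 x - l0 x)"

text \<open>Arcs come from slack zero pairs, so each term of the telescoped sum vanishes at the
  canonical representation.\<close>

lemma cycle_ineq_tight:
  assumes C: "directed_cycle prec C"
  shows "snd (cycle_ineq prec C) = fst (cycle_ineq prec C) \<bullet> apex"
proof -
  have "cycle_sum (\<lambda>x y. if blue_arc prec x y then r0 x + 1 - l0 y else l0 x - r0 y) C = 0"
    unfolding cycle_sum_def
  proof (intro sum.neutral ballI)
    fix i assume "i \<in> {..<length C}"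
    then have "key_arc prec (cyc C i) (cyc C (i + 1))" using C by (simp add: directed_cycle_def)
    then show "(if blue_arc prec (cyc C i) (cyc C (i + 1)) then r0 (cyc C i) + 1 - l0 (cyc C (i + 1))
      else l0 (cyc C i) - r0 (cyc C (i + 1))) = 0"
      by (auto simp: key_arc_def blue_arc_iff red_arc_iff)
  qed
  then show ?thesis using cycle_ineq_telescope[OF C, of r0 l0 1] by (simp add: apex_def)
qed

text \<open>With \<open>t = 0\<close>, each arc contributes exactly -1: doubling a gap of 1 gives 2
  and the extra 1 at the right endpoint takes back 1, while at a red arc the extra 1 alone
  remains.\<close>

lemma cycle_ineq_interior:
  assumes C: "directed_cycle prec C"
  shows "fst (cycle_ineq prec C) \<bullet> (\<chi> x. (2 * r0 x + 1) - 2 * l0 x) < 0"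
proof -
  have "cycle_sum (\<lambda>x y. if blue_arc prec x y then (2 * r0 x + 1) + 0 - 2 * l0 y else 2 * l0 x - (2 * r0 y + 1)) C < (\<Sum>i<length C. 0)"
    unfolding cycle_sum_def
  proof (rule sum_strict_mono)
    fix i assume "i \<in> {..<length C}"
    then have "key_arc prec (cyc C i) (cyc C (i + 1))" using C by (simp add: directed_cycle_def)
    then show "(if blue_arc prec (cyc C i) (cyc C (i + 1)) then (2 * r0 (cyc C i) + 1) + 0 - 2 * l0 (cyc C (i + 1))
      else 2 * l0 (cyc C i) - (2 * r0 (cyc C (i + 1)) + 1)) < 0"
      by (auto simp: key_arc_def blue_arc_iff red_arc_iff)
  qed (use C in \<open>auto simp: directed_cycle_def\<close>)
  then show ?thesis using cycle_ineq_telescope[OF C, of "\<lambda>x. 2 * r0 x + 1" "\<lambda>x. 2 * l0 x" 0] by simp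
qed

text \<open>The digraph of the flow argument splits each vertex \<open>x\<close> of the key graph into its left
  endpoint \<open>(x, False)\<close> and its right endpoint \<open>(x, True)\<close>.\<close>

definition endpoint_arc :: "'n \<times> bool \<Rightarrow> 'n \<times> bool \<Rightarrow> bool" where
  "endpoint_arc u v \<longleftrightarrow>
     snd u \<and> \<not> snd v \<and> blue_arc prec (fst u) (fst v) \<or> \<not> snd u \<and> snd v \<and> red_arc prec (fst u) (fst v)"

lemma sum_endpoints:
  fixes g :: "'n \<times> bool \<Rightarrow> 'b::comm_monoid_add"
  shows "sum g UNIV = (\<Sum>x\<in>UNIV. g (x, False) + g (x, True))"
proof -
  have "sum g UNIV = (\<Sum>x\<in>UNIV. \<Sum>b\<in>UNIV. g (x, b))"
    by (simp add: sum.cartesian_product flip: UNIV_Times_UNIV)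
  then show ?thesis by (simp add: UNIV_bool add.commute)
qed

text \<open>Each slack zero constraint bounds the tail of an endpoint arc by its head, and the
  indicator of a closed set does not decrease along arcs. Adding it to the canonical endpoints
  therefore preserves feasibility.\<close>

lemma closed_set_direction:
  assumes S: "closed_under endpoint_arc S"
  shows "apex + (\<chi> x. of_bool ((x, True) \<in> S) - of_bool ((x, False) \<in> S)) \<in> solution_set (cycle_system prec)"
proof -
  let ?r = "\<lambda>x. of_bool ((x, True) \<in> S) :: real" and ?l = "\<lambda>x. of_bool ((x, False) \<in> S) :: real"
  have "blue_arc prec x y \<Longrightarrow> ?r x \<le> ?l y" "red_arc prec x y \<Longrightarrow> ?l x \<le> ?r y" for x y
    using S unfolding closed_under_def endpoint_arc_def by force+
  then have "slack_zero_feasible (\<lambda>x. l0 x + ?l x) (\<lambda>x. r0 x + ?r x)"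
    by (fastforce simp: slack_zero_feasible_def blue_arc_iff red_arc_iff)
  from slack_zero_feasible_solution[OF this]
  have "(\<chi> x. (r0 x + ?r x) - (l0 x + ?l x)) \<in> solution_set (cycle_system prec)" .
  also have "(\<chi> x. (r0 x + ?r x) - (l0 x + ?l x)) = apex + (\<chi> x. ?r x - ?l x)"
    by (simp add: apex_def vec_eq_iff)
  finally show ?thesis .
qed

lemma finite_cycle_system: "finite (cycle_system prec)"
proof -
  have "{C. directed_cycle prec C} \<subseteq> {C. set C \<subseteq> UNIV \<and> length C \<le> CARD('n)}"
    by (auto simp: directed_cycle_def) (metis card_mono distinct_card finite_class.finite_UNIV subset_UNIV)
  then have "finite {C. directed_cycle prec C}"
    by (rule finite_subset[OF _ finite_lists_length_le[OF finite_class.finite_UNIV]])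
  moreover have "cycle_system prec = cycle_ineq prec ` {C. directed_cycle prec C}"
    by (auto simp: cycle_system_def)
  ultimately show ?thesis by simp
qed

lemma integral_cycle_ineq: "integral_vec (fst (cycle_ineq prec C))"
  unfolding integral_vec_def cycle_ineq_def by (auto simp: axis_def intro!: Ints_diff Ints_sum)

lemma cycle_system_generates:
  assumes c: "integral_vec c"
    and max: "\<And>z. z \<in> solution_set (cycle_system prec) \<Longrightarrow> c \<bullet> z \<le> c \<bullet> apex"
  shows "nonneg_int_combination (c, c \<bullet> apex) (cycle_system prec)"
proof -
  \<comment> \<open>A flow with these supplies has, at both endpoints of each element, a balance
    prescribed by \<open>c\<close>; the two balances cancel when the endpoints are
    identified.\<close>
  define d where "d u = (if snd u then \<lfloor>c $ fst u\<rfloor> else - \<lfloor>c $ fst u\<rfloor>)" for u :: "'n \<times> bool"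
  have cd: "of_int \<lfloor>c $ x\<rfloor> = c $ x" for x using c by (simp add: integral_vec_def)
  \<comment> \<open>The sum over a closed set is the product of \<open>c\<close> with the
    corresponding feasible direction at the apex.\<close>
  have "sum d S \<le> 0" if S: "closed_under endpoint_arc S" for S
  proof -
    let ?z = "(\<chi> x. of_bool ((x, True) \<in> S) - of_bool ((x, False) \<in> S)) :: real^'n"
    have "c \<bullet> ?z \<le> 0" using max[OF closed_set_direction[OF S]] by (simp add: inner_add_right)
    also have "c \<bullet> ?z = (\<Sum>x\<in>UNIV. c $ x * (of_bool ((x, True) \<in> S) - of_bool ((x, False) \<in> S)))"
      by (simp add: inner_vec_def)
    also have "\<dots> = of_int (\<Sum>u\<in>UNIV. if u \<in> S then d u else 0)"
      unfolding sum_endpoints of_int_sum by (intro sum.cong refl) (simp add: d_def cd)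
    also have "(\<Sum>u\<in>UNIV. if u \<in> S then d u else 0) = sum d S"
      by (simp add: sum.If_cases)
    finally show ?thesis by (simp only: of_int_le_0_iff)
  qed
  moreover have "sum d UNIV = 0" unfolding sum_endpoints by (simp add: d_def)
  ultimately obtain F where F: "\<And>u v. 0 < F u v \<Longrightarrow> endpoint_arc u v" and net: "\<And>u. net_outflow F u = d u"
    using integral_flow_exists[of endpoint_arc d] by blast
  define b where "b x y = F (x, True) (y, False)" for x y
  define \<rho> where "\<rho> x y = F (x, False) (y, True)" for x y
  have b: "blue_arc prec x y" if "0 < b x y" for x y
    using F[OF that[unfolded b_def]] by (simp add: endpoint_arc_def)
  have \<rho>: "red_arc prec x y" if "0 < \<rho> x y" for x y
    using F[OF that[unfolded \<rho>_def]] by (simp add: endpoint_arc_def)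
  have zero: "F (x, t) (y, t) = 0" for x y t using F[of "(x, t)" "(y, t)"] by (auto simp: endpoint_arc_def)
  have net_right: "(\<Sum>y\<in>UNIV. int (b x y)) - (\<Sum>y\<in>UNIV. int (\<rho> y x)) = \<lfloor>c $ x\<rfloor>" for x
    using net[of "(x, True)"] by (simp add: net_outflow_def sum_endpoints zero b_def \<rho>_def d_def)
  have net_left: "(\<Sum>y\<in>UNIV. int (\<rho> x y)) - (\<Sum>y\<in>UNIV. int (b y x)) = - \<lfloor>c $ x\<rfloor>" for x
    using net[of "(x, False)"] by (simp add: net_outflow_def sum_endpoints zero b_def \<rho>_def d_def)
  define f where "f x y = b x y + \<rho> x y" for x y
  have "net_outflow f x = 0" for x
    using net_right[of x] net_left[of x] by (simp add: net_outflow_def f_def sum.distrib)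
  then obtain Cs where Cs: "\<And>C. C \<in> set Cs \<Longrightarrow> cycle_in (\<lambda>x y. 0 < f x y) C"
    and sum: "(\<Sum>x\<in>UNIV. \<Sum>y\<in>UNIV. real (f x y) *\<^sub>R arc_weight prec x y) = (\<Sum>C\<leftarrow>Cs. cycle_sum (arc_weight prec) C)"
    using circulation_decomposition[of f "arc_weight prec"] by blast
  have dir: "directed_cycle prec C" if "C \<in> set Cs" for C
    using Cs[OF that] b \<rho> by (auto simp: directed_cycle_def cycle_in_def f_def key_arc_def)
  \<comment> \<open>No ordered pair is both blue and red, so \<open>f\<close> agrees with
    \<open>b\<close> or with \<rho> on each pair, and the weight charges the tail of a blue arc or
    the head of a red one.\<close>
  have "real (f x y) *\<^sub>R fst (snd (arc_weight prec x y)) = real (b x y) *\<^sub>R axis x 1 - real (\<rho> x y) *\<^sub>R axis y 1" for x y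
    using b[of x y] \<rho>[of x y] not_blue_and_red[of prec x y]
    by (cases "b x y = 0"; cases "\<rho> x y = 0") (auto simp: f_def arc_weight_def)
  then have "fst (snd (\<Sum>x\<in>UNIV. \<Sum>y\<in>UNIV. real (f x y) *\<^sub>R arc_weight prec x y)) =
      (\<Sum>x\<in>UNIV. \<Sum>y\<in>UNIV. real (b x y) *\<^sub>R axis x 1 - real (\<rho> x y) *\<^sub>R axis y 1)"
    by (simp add: fst_sum snd_sum)
  also have "\<dots> = c"
  proof (rule vec_eq_iff[THEN iffD2], rule allI)
    fix z
    have comp: "(real n *\<^sub>R axis x 1 :: real^'n) $ z = (if x = z then real n else 0)" for n x
      by (simp add: axis_def)
    have "(\<Sum>x\<in>UNIV. \<Sum>y\<in>UNIV. real (b x y) *\<^sub>R axis x 1 - real (\<rho> x y) *\<^sub>R axis y 1) $ z =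
      (\<Sum>x\<in>UNIV. \<Sum>y\<in>UNIV. if x = z then real (b x y) else 0) - (\<Sum>x\<in>UNIV. \<Sum>y\<in>UNIV. if y = z then real (\<rho> x y) else 0)"
      by (simp only: sum_component vector_minus_component comp sum_subtractf)
    also have "(\<Sum>x\<in>UNIV. \<Sum>y\<in>UNIV. if x = z then real (b x y) else 0) = (\<Sum>y\<in>UNIV. real (b z y))"
      by (subst sum.swap) simp
    also have "(\<Sum>x\<in>UNIV. \<Sum>y\<in>UNIV. if y = z then real (\<rho> x y) else 0) = (\<Sum>x\<in>UNIV. real (\<rho> x z))"
      by simp
    also have "(\<Sum>y\<in>UNIV. real (b z y)) - (\<Sum>x\<in>UNIV. real (\<rho> x z)) =
        of_int ((\<Sum>y\<in>UNIV. int (b z y)) - (\<Sum>y\<in>UNIV. int (\<rho> y z)))" by simp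
    finally show "(\<Sum>x\<in>UNIV. \<Sum>y\<in>UNIV. real (b x y) *\<^sub>R axis x 1 - real (\<rho> x y) *\<^sub>R axis y 1) $ z = c $ z"
      by (simp only: net_right cd)
  qed
  finally have c_eq: "c = fst (snd (\<Sum>C\<leftarrow>Cs. cycle_sum (arc_weight prec) C))" by (simp add: sum)
  have "(\<Sum>C\<leftarrow>Cs. cycle_sum (arc_weight prec) C) = (\<Sum>C\<leftarrow>Cs. (0, cycle_ineq prec C))"
    by (rule arg_cong[where f = sum_list], rule map_cong[OF refl])
      (unfold cycle_sum_def, rule sum_arc_weights[OF dir])
  also have "\<dots> = (0, \<Sum>C\<leftarrow>Cs. cycle_ineq prec C)" by (induction Cs) (simp_all add: zero_prod_def)
  finally have c_sum: "c = fst (\<Sum>C\<leftarrow>Cs. cycle_ineq prec C)" using c_eq by simp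
  \<comment> \<open>The flow controls only the coefficients; tightness at the apex then fixes the
    right-hand side.\<close>
  have "snd (\<Sum>C\<leftarrow>Cs. cycle_ineq prec C) = fst (\<Sum>C\<leftarrow>Cs. cycle_ineq prec C) \<bullet> apex"
    using dir by (induction Cs) (simp_all add: cycle_ineq_tight inner_add_left)
  then have "(c, c \<bullet> apex) = (\<Sum>C\<leftarrow>Cs. cycle_ineq prec C)"
    by (intro prod_eqI) (simp_all add: c_sum)
  moreover have "nonneg_int_combination (\<Sum>C\<leftarrow>Cs. cycle_ineq prec C) (cycle_system prec)"
    using dir
  proof (induction Cs)
    case (Cons C Cs)
    have "cycle_ineq prec C \<in> cycle_system prec" using Cons.prems by (auto simp: cycle_system_def)
    then show ?case using Cons
      by (simp add: nonneg_int_combination_add nonneg_int_combination_mem finite_cycle_system)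
  qed (simp add: nonneg_int_combination_0)
  ultimately show ?thesis by simp
qed

sublocale cycles: tight_system "cycle_system prec" apex "\<chi> x. (2 * r0 x + 1) - 2 * l0 x"
proof
  show "finite (cycle_system prec)" by (rule finite_cycle_system)
  fix I assume "I \<in> cycle_system prec"
  then obtain C where I: "I = cycle_ineq prec C" and C: "directed_cycle prec C"
    unfolding cycle_system_def by blast
  show "integral_vec (fst I)" unfolding I by (rule integral_cycle_ineq)
  show "snd I = fst I \<bullet> apex" unfolding I by (rule cycle_ineq_tight[OF C])
  show "fst I \<bullet> (\<chi> x. (2 * r0 x + 1) - 2 * l0 x) < 0" unfolding I by (rule cycle_ineq_interior[OF C])
qed (rule cycle_system_generates)

lemma reduced_cycle_system_eq: "reduced_cycle_system prec = cycles.reduced"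
  by (simp add: reduced_cycle_system_def cycles.reduced_def)

end

theorem theorem3p4:
  fixes prec :: "'n::finite \<Rightarrow> 'n \<Rightarrow> bool"
  assumes "interval_order prec"
  shows "(\<exists>!S. schrijver_system (length_polyhedron prec) S) \<and>
         schrijver_system (length_polyhedron prec) (reduced_cycle_system prec)"
proof -
  interpret canonical_interval_rep prec "fst (canonical_rep prec)" "snd (canonical_rep prec)"
    using canonical_rep_is_canonical[OF assms] by unfold_locales simp_all
  show ?thesis
    using cycles.unique_schrijver_system
    by (simp add: solution_set_cycle_system reduced_cycle_system_eq)
qed


end
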